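(* Let $C$ be a closed convex cone in $\mathbb{R}^d$, and let $\delta(C)$ be its statistical dimension. The following hold, where $g$ is a standard normal vector in $\mathbb{R}^d$ and $\theta$ is uniformly distributed on the unit sphere $\mathsf{S}^{d-1}$. 1. (Intrinsic formulation) $\delta(C)=\sum_{k=0}^d k\,v_k(C)$ (this is the definition). 2. (Gaussian formulation) $\delta(C)=\mathbb{E}[\|\Pi_C(g)\|^2]$. 3. (Spherical formulation) $\delta(C)=d\,\mathbb{E}[\|\Pi_C(\theta)\|^2]$. 4. (Polar formulation) $\delta(C)=\mathbb{E}[\mathrm{dist}^2(g,C^\circ)]$. 5. (Mean-squared-width formulation) $\delta(C)=\mathbb{E}\big[\big(\sup_{y\in C\cap \mathsf{B}^d}\langle y,g\rangle\big)^2\big]$, where $\mathsf{B}^d$ is the closed Euclidean unit ball. 6. (Rotational invariance) $\delta(UC)=\delta(C)$ for each orthogonal matrix $U\in\mathbb{R}^{d\times d}$. 7. (Subspaces) $\delta(L)=\dim(L)$ for each linear subspace $L$. 8. (Complementarity) $\delta(C)+\delta(C^\circ)=d$. 9. (Direct products) For each closed convex cone $K\subset\mathbb{R}^d$, $\delta(C\times K)=\delta(C)+\delta(K)$. In particular, the statistical dimension is invariant under embedding: $\delta(C\times\{0_{d'}\})=\delta(C)$, where $0_{d'}$ is the zero vector of $\mathbb{R}^{d'}$. 10. (Monotonicity) For each closed convex cone $K\subset\mathbb{R}^d$, $C\subset K$ implies $\delta(C)\le\delta(K)$.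
   Context: A convex cone in $\mathbb{R}^d$ is a (nonempty) convex set $C$ with $C=\tau C$ for all $\tau>0$. For a closed convex cone $C$, $\Pi_C(x)$ denotes the point of $C$ nearest to $x$ in Euclidean norm, $\mathrm{dist}(x,S)=\inf_{y\in S}\|x-y\|$, and the polar cone is $C^\circ=\{u\in\mathbb{R}^d:\langle u,x\rangle\le 0\text{ for all }x\in C\}$. Conic intrinsic volumes: a cone is polyhedral if it is an intersection of finitely many closed halfspaces with the origin on their boundary. For a polyhedral cone $C\subset\mathbb{R}^d$ and $k=0,\dots,d$, $v_k(C) := \mathbb{P}\{\Pi_C(g)$ lies in the relative interior of a $k$-dimensional face of $C\}$. For a general closed convex cone $C$, $v_k(C):=\lim_{i\to\infty} v_k(C_i)$, where $(C_i)$ is any sequence of polyhedral cones converging to $C$ in the conic Hausdorff metric (identify each closed convex cone with its intersection with the unit sphere $\mathsf{S}^{d-1}$ and use the Hausdorff metric on the sphere); the limit does not depend on the sequence. The statistical dimension is $\delta(C):=\sum_{k=0}^d k\,v_k(C)$. *)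

theory Defs
  imports "HOL-Probability.Probability"
begin

section \<open>Convex cones\<close>

text \<open>
  Only dilations by positive factors are required, so this is not the library's
  \<^const>\<open>convex_cone\<close>, which allows the factor 0. For closed sets the two notions agree.
\<close>

definition closed_convex_cone :: "'a::euclidean_space set \<Rightarrow> bool" where
  "closed_convex_cone C \<longleftrightarrow>
     closed C \<and> convex C \<and> C \<noteq> {} \<and> (\<forall>\<tau>>0. C = (\<lambda>x. \<tau> *\<^sub>R x) ` C)"

definition polar_cone :: "'a::euclidean_space set \<Rightarrow> 'a set" where
  "polar_cone C = {u. \<forall>x\<in>C. u \<bullet> x \<le> 0}"

text \<open>The empty intersection is allowed: the whole space is a polyhedral cone.\<close>

definition polyhedral_cone :: "'a::euclidean_space set \<Rightarrow> bool" where
  "polyhedral_cone C \<longleftrightarrow>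
     (\<exists>H. finite H \<and> C = \<Inter>H \<and> (\<forall>h\<in>H. \<exists>a. a \<noteq> 0 \<and> h = {x. a \<bullet> x \<le> 0}))"

definition hausdorff_dist :: "'a::metric_space set \<Rightarrow> 'a set \<Rightarrow> real" where
  "hausdorff_dist A B = max (SUP a\<in>A. infdist a B) (SUP b\<in>B. infdist b A)"

text \<open>
  The unit sphere carries the Euclidean distance; the geodesic distance gives the same notion
  of convergence. The cone \<open>{0}\<close> misses the sphere, and the Hausdorff distance does not cover
  the empty set. We put \<open>{0}\<close> at distance 2, the diameter of the sphere, from every
  other closed convex cone, so it is an isolated point.
\<close>

definition conic_hausdorff_dist :: "'a::euclidean_space set \<Rightarrow> 'a set \<Rightarrow> real" where
  "conic_hausdorff_dist C D =
     (if C \<inter> sphere 0 1 = {} \<and> D \<inter> sphere 0 1 = {} then 0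
      else if C \<inter> sphere 0 1 = {} \<or> D \<inter> sphere 0 1 = {} then 2
      else hausdorff_dist (C \<inter> sphere 0 1) (D \<inter> sphere 0 1))"

section \<open>Standard normal vectors and uniform random points of the unit sphere\<close>

definition std_gaussian_density :: "'a::euclidean_space \<Rightarrow> real" where
  "std_gaussian_density x = (\<Prod>b\<in>Basis. std_normal_density (x \<bullet> b))"

definition std_gaussian :: "'a::euclidean_space measure" where
  "std_gaussian = density lborel (\<lambda>x. ennreal (std_gaussian_density x))"

definition std_normal_vector :: "'w measure \<Rightarrow> ('w \<Rightarrow> 'a::euclidean_space) \<Rightarrow> bool" where
  "std_normal_vector M g \<longleftrightarrow>
     prob_space M \<and> distributed M lborel g (\<lambda>x. ennreal (std_gaussian_density x))"

text \<open>
  Normalized spherical Lebesgue measure, as a Borel measure on the ambient space: the measure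
  of \<open>A\<close> is the proportion of the unit ball covered by the rays through the points of \<open>A\<close> on
  the sphere. The origin, where the radial projection has the junk value 0, is a null set.
\<close>

definition uniform_sphere :: "'a::euclidean_space measure" where
  "uniform_sphere = distr (uniform_measure lborel (cball 0 1)) borel (\<lambda>x. x /\<^sub>R norm x)"

definition uniform_on_sphere :: "'w measure \<Rightarrow> ('w \<Rightarrow> 'a::euclidean_space) \<Rightarrow> bool" where
  "uniform_on_sphere M \<theta> \<longleftrightarrow>
     prob_space M \<and> \<theta> \<in> borel_measurable M \<and> distr M borel \<theta> = uniform_sphere"

section \<open>Conic intrinsic volumes and statistical dimension\<close>

definition polyhedral_intrinsic_volume :: "nat \<Rightarrow> 'a::euclidean_space set \<Rightarrow> real" where
  "polyhedral_intrinsic_volume k C =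
     measure std_gaussian
       {x. \<exists>F. F face_of C \<and> aff_dim F = int k \<and> closest_point C x \<in> rel_interior F}"

definition conic_intrinsic_volume :: "nat \<Rightarrow> 'a::euclidean_space set \<Rightarrow> real" where
  "conic_intrinsic_volume k C =
     (if polyhedral_cone C then polyhedral_intrinsic_volume k C
      else (THE v. \<forall>D :: nat \<Rightarrow> 'a set.
              (\<forall>i. polyhedral_cone (D i)) \<and> (\<lambda>i. conic_hausdorff_dist (D i) C) \<longlonglongrightarrow> 0
              \<longrightarrow> (\<lambda>i. polyhedral_intrinsic_volume k (D i)) \<longlonglongrightarrow> v))"

definition statistical_dimension :: "'a::euclidean_space set \<Rightarrow> real" where
  "statistical_dimension C = (\<Sum>k=0..DIM('a). real k * conic_intrinsic_volume k C)"

end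

(*
  For a polyhedral cone C, decompose space into the regions R_F on which the projection onto C falls
  in the relative interior of a face F. On R_F the projection onto C agrees with the orthogonal
  projection onto span F, and R_F is invariant under dilations along span F, so a linear change of
  variables gives
    E exp (-s |P_C g|^2) = SUM_k v_k(C) (1 + 2 s)^(-k/2).
  By interpolation in the variable (1 + 2 s)^(-1/2), each v_k(C) is a fixed linear combination of the
  values of the left-hand side at s = 0, ..., d. These values are continuous in C because |P_C x| is
  the maximum of y . x over unit vectors y in C (or 0), which is Lipschitz in the Hausdorff distance.
  Hence the limits defining v_k exist, the identity holds for all closed convex cones, and its derivative
  at s = 0 is the Gaussian formulation. The other items follow from that one through pointwise
  identities for projections and the symmetries of the Gaussian measure.
*)

theory Submission
  imports Defs "HOL-Computational_Algebra.Polynomial" "HOL-Real_Asymp.Real_Asymp"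
begin

section \<open>Invariance of Lebesgue measure\<close>

text \<open>The \<open>v_k\<close> resist a direct passage to the limit: faces of approximating
  polyhedral cones need not converge to faces of the limit cone, whereas the length of the
  projection depends continuously on the cone. The Laplace transform stores all \<open>v_k\<close>
  in that length alone. It works because E exp (-s Z^2) = (1 + 2 s)^(-1/2) for a standard normal Z:
  on the region of a face F the squared length is distributed like a sum of dim F independent
  squares of this kind, since dilation invariance makes the event itself independent of that length.
  The interpolation weights depend only on d and the nodes, so one formula serves the approximants
  and the limit. The slope of (1 + 2 s)^(-k/2) at 0 is -k, which is where the coefficients k of the
  statistical dimension come from. The lemmas are stated over arbitrary Euclidean spaces, so that
  they also cover products of cones, which live in a product type.\<close>

lemma orthogonal_transformation_orthonormal_images:
  fixes \<phi> :: "'a::euclidean_space \<Rightarrow> 'a"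
  assumes "\<And>b c. b \<in> Basis \<Longrightarrow> c \<in> Basis \<Longrightarrow> \<phi> b \<bullet> \<phi> c = (if b = c then 1 else 0)"
  shows "orthogonal_transformation (\<lambda>x. \<Sum>b\<in>Basis. (x \<bullet> b) *\<^sub>R \<phi> b)"
proof -
  have "(\<Sum>b\<in>Basis. (x \<bullet> b) *\<^sub>R \<phi> b) \<bullet> (\<Sum>b\<in>Basis. (y \<bullet> b) *\<^sub>R \<phi> b) = x \<bullet> y" for x y
  proof -
    have "(\<Sum>b\<in>Basis. (x \<bullet> b) *\<^sub>R \<phi> b) \<bullet> (\<Sum>b\<in>Basis. (y \<bullet> b) *\<^sub>R \<phi> b)
        = (\<Sum>b\<in>Basis. \<Sum>c\<in>Basis. (x \<bullet> b) * (y \<bullet> c) * (\<phi> b \<bullet> \<phi> c))"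
      by (subst sum.swap) (simp add: inner_sum_left inner_sum_right sum_distrib_left mult_ac)
    also have "\<dots> = (\<Sum>b\<in>Basis. \<Sum>c\<in>Basis. if b = c then (x \<bullet> b) * (y \<bullet> c) else 0)"
      by (intro sum.cong refl) (auto simp: assms)
    also have "\<dots> = x \<bullet> y"
      by (simp add: euclidean_inner[of x y])
    finally show ?thesis .
  qed
  moreover have "linear (\<lambda>x. \<Sum>b\<in>Basis. (x \<bullet> b) *\<^sub>R \<phi> b)"
    by (intro linear_compose_sum ballI linearI) (auto simp: inner_add_left scaleR_add_left)
  ultimately show ?thesis by (simp add: orthogonal_transformation_def)
qed

lemma nn_integral_lborel_homothety:
  fixes f :: "'a::euclidean_space \<Rightarrow> ennreal"
  assumes [measurable]: "f \<in> borel_measurable borel" and c: "c \<noteq> 0"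
  shows "(\<integral>\<^sup>+x. f x \<partial>lborel) = ennreal (\<bar>c\<bar> ^ DIM('a)) * (\<integral>\<^sup>+x. f (t + c *\<^sub>R x) \<partial>lborel)"
  by (subst lborel_affine[OF c, of t]) (simp add: nn_integral_density nn_integral_distr nn_integral_cmult)

text \<open>
  Uniqueness of Haar measure: for a translation invariant \<open>\<mu>\<close>, Fubini applied to
  \<open>\<integral>\<integral> 1\<^sub>A(x) 1\<^sub>B(y - x)\<close> gives \<open>vol A * \<mu> B = vol B * \<mu> A\<close>; here \<open>\<mu>\<close> is the image of the volume
  under the orthogonal map and \<open>B\<close> is the unit ball.
\<close>

lemma distr_lborel_orthogonal_transformation:
  fixes f :: "'a::euclidean_space \<Rightarrow> 'a"
  assumes f: "orthogonal_transformation f"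
  shows "distr lborel borel f = lborel"
proof (rule measure_eqI)
  have lin: "linear f" by (rule orthogonal_transformation_linear[OF f])
  have [measurable]: "f \<in> borel \<rightarrow>\<^sub>M borel"
    by (intro borel_measurable_continuous_onI linear_continuous_on linear_conv_bounded_linear[THEN iffD1] lin)
  let ?B = "ball 0 1 :: 'a set"
  have [measurable]: "?B \<in> sets borel" by simp
  have bijf: "bij f" by (rule orthogonal_transformation_bij[OF f])
  fix A :: "'a set" assume "A \<in> sets (distr lborel borel f)"
  then have [measurable]: "A \<in> sets borel" by simp
  have 1: "emeasure lborel A * emeasure lborel ?B
      = (\<integral>\<^sup>+x. \<integral>\<^sup>+y. indicator A x * indicator ?B (f y - x) \<partial>lborel \<partial>lborel)"
  proof -
    have "(\<integral>\<^sup>+y. indicator A x * indicator ?B (f y - x) \<partial>lborel) = indicator A x * emeasure lborel ?B" for x :: 'a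
    proof -
      \<comment> \<open>Writing x = f z turns f y - x into f (y - z). The isometry preserves
        membership in the ball, so \<open>f\<close> drops out and a translation removes z.\<close>
      obtain z where z: "x = f z" using bijf by (metis bij_pointE)
      have "(\<integral>\<^sup>+y. indicator A x * indicator ?B (f y - x) \<partial>lborel)
          = indicator A x * (\<integral>\<^sup>+y. indicator ?B (f y - f z) \<partial>lborel)"
        unfolding z by (rule nn_integral_cmult) measurable
      also have "(\<integral>\<^sup>+y. indicator ?B (f y - f z) \<partial>lborel) = (\<integral>\<^sup>+y. indicator ?B (y - z) \<partial>lborel)"
        using f by (intro nn_integral_cong)
          (auto simp: indicator_def orthogonal_transformation_norm linear_diff[OF lin, symmetric])
      also have "\<dots> = (\<integral>\<^sup>+y. indicator ?B (z + 1 *\<^sub>R y - z) \<partial>lborel)"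
        using nn_integral_lborel_homothety[where c = 1 and t = z
            and f = "\<lambda>y. indicator ?B (y - z)"] by simp
      also have "\<dots> = emeasure lborel ?B" by simp
      finally show ?thesis .
    qed
    then show ?thesis by (simp add: nn_integral_multc)
  qed
  also have "\<dots> = (\<integral>\<^sup>+y. \<integral>\<^sup>+x. indicator A x * indicator ?B (f y - x) \<partial>lborel \<partial>lborel)"
    by (rule lborel_pair.Fubini') measurable
  also have "\<dots> = (\<integral>\<^sup>+y. \<integral>\<^sup>+x. indicator A (f y + (-1) *\<^sub>R x) * indicator ?B x \<partial>lborel \<partial>lborel)"
  proof (rule nn_integral_cong)
    fix y
    show "(\<integral>\<^sup>+x. indicator A x * indicator ?B (f y - x) \<partial>lborel)
        = (\<integral>\<^sup>+x. indicator A (f y + (-1) *\<^sub>R x) * indicator ?B x \<partial>lborel)"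
      \<comment> \<open>The reflection x -> f y - x moves the dependence on y from the ball to
        \<open>A\<close>.\<close>
      using nn_integral_lborel_homothety[where c = "-1" and t = "f y"
          and f = "\<lambda>x. indicator A x * indicator ?B (f y - x)"] by simp
  qed
  also have "\<dots> = (\<integral>\<^sup>+x. \<integral>\<^sup>+y. indicator A (f y + (-1) *\<^sub>R x) * indicator ?B x \<partial>lborel \<partial>lborel)"
    by (rule lborel_pair.Fubini') measurable
  also have "\<dots> = emeasure (distr lborel borel f) A * emeasure lborel ?B"
  proof -
    have "(\<integral>\<^sup>+y. indicator A (f y + (-1) *\<^sub>R x) * indicator ?B x \<partial>lborel)
        = emeasure (distr lborel borel f) A * indicator ?B x" for x :: 'a
    proof -
      obtain z where z: "x = f z" using bijf by (metis bij_pointE)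
      have "(\<integral>\<^sup>+y. indicator A (f y + (-1) *\<^sub>R x) \<partial>lborel) = (\<integral>\<^sup>+y. indicator A (f (y - z)) \<partial>lborel)"
        by (simp add: z linear_diff[OF lin])
      also have "\<dots> = (\<integral>\<^sup>+y. indicator A (f (z + 1 *\<^sub>R y - z)) \<partial>lborel)"
        using nn_integral_lborel_homothety[where c = 1 and t = z
            and f = "\<lambda>y. indicator A (f (y - z))"] by simp
      also have "\<dots> = (\<integral>\<^sup>+y. indicator A y \<partial>distr lborel borel f)"
        by (subst nn_integral_distr) auto
      also have "\<dots> = emeasure (distr lborel borel f) A" by (subst nn_integral_indicator) auto
      finally show ?thesis by (simp add: nn_integral_multc)
    qed
    then show ?thesis by (simp add: nn_integral_cmult)
  qed
  finally have eq: "emeasure lborel A * emeasure lborel ?B = emeasure (distr lborel borel f) A * emeasure lborel ?B" .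
  have fin: "emeasure lborel ?B \<noteq> \<infinity>" using emeasure_bounded_finite[OF bounded_ball, of "0::'a" 1] by simp
  have "emeasure lborel ?B \<noteq> 0"
    using unit_ball_vol_pos[of "real DIM('a)"] by (simp add: emeasure_ball del: unit_ball_vol_pos)
  with eq fin show "emeasure (distr lborel borel f) A = emeasure lborel A"
    by (metis ennreal_mult_cancel_left mult.commute infinity_ennreal_def top.not_eq_extremum)
qed simp

lemma nn_integral_lborel_orthogonal_transformation:
  fixes f :: "'a::euclidean_space \<Rightarrow> 'a"
  assumes f: "orthogonal_transformation f" and [measurable]: "g \<in> borel_measurable borel"
  shows "(\<integral>\<^sup>+x. g (f x) \<partial>lborel) = (\<integral>\<^sup>+x. g x \<partial>lborel)"
proof -
  have [measurable]: "f \<in> borel \<rightarrow>\<^sub>M borel"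
    by (intro borel_measurable_continuous_onI linear_continuous_on linear_conv_bounded_linear[THEN iffD1]
        orthogonal_transformation_linear f)
  have "(\<integral>\<^sup>+x. g (f x) \<partial>lborel) = (\<integral>\<^sup>+x. g x \<partial>distr lborel borel f)"
    by (simp add: nn_integral_distr)
  then show ?thesis by (simp add: distr_lborel_orthogonal_transformation[OF f])
qed

section \<open>Closed convex cones and dilations along a subspace\<close>

lemma closed_convex_coneD:
  assumes "closed_convex_cone C"
  shows "closed C" "convex C" "C \<noteq> {}" "0 \<in> C" "\<And>x t. x \<in> C \<Longrightarrow> t \<ge> 0 \<Longrightarrow> t *\<^sub>R x \<in> C"
    "\<And>x y. x \<in> C \<Longrightarrow> y \<in> C \<Longrightarrow> x + y \<in> C"
proof -
  show 1: "closed C" "convex C" "C \<noteq> {}" using assms unfolding closed_convex_cone_def by blast+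
  have sc: "t *\<^sub>R x \<in> C" if "x \<in> C" "t > 0" for t x
  proof -
    have "C = (\<lambda>x. t *\<^sub>R x) ` C" using assms that unfolding closed_convex_cone_def by blast
    with that(1) show ?thesis by blast
  qed
  obtain x where x: "x \<in> C" using 1 by auto
  \<comment> \<open>Only positive factors are given, so 0 is obtained as the limit of the points x /
    (n + 1), by closedness.\<close>
  have "(\<lambda>n. (1 / real (Suc n)) *\<^sub>R x) \<longlonglongrightarrow> 0 *\<^sub>R x"
    by (intro tendsto_intros LIMSEQ_Suc lim_1_over_n)
  then have "(\<lambda>n. (1 / real (Suc n)) *\<^sub>R x) \<longlonglongrightarrow> 0" by simp
  moreover have "\<forall>n. (1 / real (Suc n)) *\<^sub>R x \<in> C" using sc[OF x] by simp
  ultimately show 0: "0 \<in> C"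
    using closed_sequentially[OF 1(1), of "\<lambda>n. (1 / real (Suc n)) *\<^sub>R x" 0] by blast
  show sc0: "t *\<^sub>R x \<in> C" if "x \<in> C" "t \<ge> 0" for t x
    using that sc 0 by (cases "t = 0") auto
  show "x + y \<in> C" if "x \<in> C" "y \<in> C" for x y
  proof -
    have "2 *\<^sub>R ((1/2) *\<^sub>R x + (1/2) *\<^sub>R y) \<in> C"
      using that 1(2) by (intro sc0 convexD) auto
    then show ?thesis by (simp add: scaleR_add_right)
  qed
qed

lemma closed_convex_coneI:
  assumes "closed C" "convex C" "C \<noteq> {}" and sc: "\<And>x t. x \<in> C \<Longrightarrow> t > 0 \<Longrightarrow> t *\<^sub>R x \<in> C"
  shows "closed_convex_cone C"
proof -
  have "C = (\<lambda>x. t *\<^sub>R x) ` C" if t: "t > 0" for t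
  proof (intro equalityI subsetI)
    fix x assume "x \<in> C"
    then have "(1/t) *\<^sub>R x \<in> C" using sc t by simp
    then show "x \<in> (\<lambda>x. t *\<^sub>R x) ` C" using t by (intro image_eqI[of _ _ "(1/t) *\<^sub>R x"]) auto
  qed (use sc t in auto)
  then show ?thesis using assms(1-3) unfolding closed_convex_cone_def by blast
qed

text \<open>The variational inequality at the nearest point p, tested at z = 0 and z = 2 p, forces
  the residual to be orthogonal to p; what remains of the inequality puts the residual in the polar
  cone.\<close>

lemma closest_point_cone:
  assumes C: "closed_convex_cone C"
  shows "closest_point C x \<in> C" "(x - closest_point C x) \<bullet> closest_point C x = 0"
    "\<And>z. z \<in> C \<Longrightarrow> (x - closest_point C x) \<bullet> z \<le> 0"
proof -
  note CD = closed_convex_coneD[OF C]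
  let ?p = "closest_point C x"
  show p: "?p \<in> C" using closest_point_in_set CD by blast
  have dot: "(x - ?p) \<bullet> (z - ?p) \<le> 0" if "z \<in> C" for z
    using closest_point_dot CD that by blast
  have "(x - ?p) \<bullet> ?p \<ge> 0" using dot[OF CD(4)] by (simp add: inner_diff_right)
  moreover have "(x - ?p) \<bullet> ?p \<le> 0"
    using dot[OF CD(5)[OF p, of 2]] by (simp add: scaleR_2)
  ultimately show "(x - ?p) \<bullet> ?p = 0" by simp
  then show "(x - ?p) \<bullet> z \<le> 0" if "z \<in> C" for z using dot[OF that] by (simp add: inner_diff_right)
qed

text \<open>Expanding |x - z|^2 around y leaves |x - y|^2 plus nonnegative terms. Most later
  identifications of a projection consist in checking these three conditions.\<close>

lemma closest_point_coneI:
  assumes C: "closed_convex_cone C" and y: "y \<in> C" "(x - y) \<bullet> y = 0" "\<And>z. z \<in> C \<Longrightarrow> (x - y) \<bullet> z \<le> 0"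
  shows "closest_point C x = y"
proof -
  have "dist x y \<le> dist x z" if "z \<in> C" for z
  proof -
    have "(x - y) \<bullet> (z - y) \<le> 0" using y(2) y(3)[OF that] by (simp add: inner_diff_right)
    then have "(norm (x - y))\<^sup>2 \<le> (norm (x - z))\<^sup>2"
      unfolding power2_norm_eq_inner using inner_ge_zero[of "z - y"]
      by (simp add: inner_diff inner_commute algebra_simps)
    then show ?thesis by (simp add: dist_norm)
  qed
  then show ?thesis using closest_point_unique closed_convex_coneD[OF C] y(1) by metis
qed

lemma subspace_closed_convex_cone:
  assumes "subspace (S::'a::euclidean_space set)" shows "closed_convex_cone S"
  using assms
  by (intro closed_convex_coneI closed_subspace subspace_imp_convex) (auto simp: subspace_def)

lemma closest_point_subspace:
  assumes S: "subspace (S::'a::euclidean_space set)" and z: "z \<in> S"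
  shows "(x - closest_point S x) \<bullet> z = 0"
  using closest_point_cone(3)[OF subspace_closed_convex_cone[OF S], of z x]
    closest_point_cone(3)[OF subspace_closed_convex_cone[OF S], of "-z" x] z subspace_neg[OF S, of z]
  by simp

lemma borel_measurable_closest_point [measurable]:
  assumes "closed_convex_cone C" shows "closest_point C \<in> borel_measurable borel"
  using closed_convex_coneD(1-3)[OF assms]
  by (intro borel_measurable_continuous_onI continuous_on_closest_point)

text \<open>The map x + (l - 1) P x multiplies \<open>S\<close> by \<open>l\<close> and fixes its
  orthogonal complement, so its determinant is l^(dim S). A rotation reduces it to a diagonal
  map.\<close>

lemma nn_integral_lborel_subspace_scaling:
  fixes S :: "'a::euclidean_space set"
  assumes S: "subspace S" and l: "l > 0" and [measurable]: "g \<in> borel_measurable borel"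
  shows "(\<integral>\<^sup>+x. g x \<partial>lborel) = ennreal (l ^ dim S) * (\<integral>\<^sup>+x. g (x + (l - 1) *\<^sub>R closest_point S x) \<partial>lborel)"
proof -
  have CS: "closed_convex_cone S" by (rule subspace_closed_convex_cone[OF S])
  note [measurable] = borel_measurable_closest_point[OF CS]
  obtain B where B: "B \<subseteq> S" "pairwise orthogonal B" "\<And>x. x \<in> B \<Longrightarrow> norm x = 1"
    "independent B" "card B = dim S" "span B = S"
    using orthonormal_basis_subspace[OF S] by blast
  define S' where "S' = {y. \<forall>x\<in>S. orthogonal x y}"
  have S': "subspace S'" unfolding S'_def by (rule subspace_orthogonal_to_vectors)
  obtain B' where B': "B' \<subseteq> S'" "pairwise orthogonal B'" "\<And>x. x \<in> B' \<Longrightarrow> norm x = 1"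
    "independent B'" "card B' = dim S'" "span B' = S'"
    using orthonormal_basis_subspace[OF S'] by blast
  have fin: "finite B" "finite B'" using B B' independent_imp_finite by auto
  have orth: "x \<bullet> y = 0" if "x \<in> B" "y \<in> B'" for x y
    using that B(1) B'(1) by (auto simp: S'_def orthogonal_def)
  have orth': "x \<bullet> y = 0" if "x \<in> B'" "y \<in> B" for x y
    using orth[OF that(2,1)] by (simp add: inner_commute)
  have disj: "B \<inter> B' = {}" using orth B(3) by (metis disjoint_iff norm_eq_1 zero_neq_one)
  have "dim S' + dim S = DIM('a)"
    using dim_subspace_orthogonal_to_vectors[OF S subspace_UNIV] by (simp add: S'_def dim_UNIV)
  then have "card (B \<union> B') = card (Basis :: 'a set)"
    using B(5) B'(5) fin disj by (simp add: card_Un_disjoint)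
  \<comment> \<open>An orthonormal basis adapted to \<open>S\<close> and its complement has as many
    elements as the standard basis; any bijection between the two extends to an orthogonal
    map.\<close>
  then obtain \<phi> where \<phi>: "bij_betw \<phi> (Basis :: 'a set) (B \<union> B')"
    using fin finite_Basis by (metis bij_betw_iff_card finite_Un)
  have \<phi>in: "\<phi> b \<in> B \<or> \<phi> b \<in> B'" if "b \<in> Basis" for b
    using \<phi> that by (auto simp: bij_betw_def)
  have \<phi>orth: "\<phi> b \<bullet> \<phi> c = (if b = c then 1 else 0)" if bc: "b \<in> Basis" "c \<in> Basis" for b c
  proof (cases "b = c")
    case True
    then show ?thesis using \<phi>in[OF bc(1)] B(3) B'(3) by (auto simp: norm_eq_1)
  next
    case False
    then have "\<phi> b \<noteq> \<phi> c" using \<phi> bc by (auto simp: bij_betw_def inj_on_def)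
    then show ?thesis using \<phi>in[OF bc(1)] \<phi>in[OF bc(2)] B(2) B'(2) orth False
      unfolding pairwise_def orthogonal_def using orth' by metis
  qed
  define f where "f x = (\<Sum>b\<in>Basis. (x \<bullet> b) *\<^sub>R \<phi> b)" for x
  have f: "orthogonal_transformation f"
    unfolding f_def by (rule orthogonal_transformation_orthonormal_images) (rule \<phi>orth)
  have [measurable]: "f \<in> borel_measurable borel" unfolding f_def by measurable
  define K where "K = {b\<in>Basis. \<phi> b \<in> B}"
  have "\<phi> ` K = B" using \<phi> by (force simp: K_def bij_betw_def)
  moreover have "inj_on \<phi> K" using \<phi> by (auto simp: K_def bij_betw_def inj_on_def)
  ultimately have cardK: "card K = dim S" using B(5) card_image by metis
  define c where "c b = (if b \<in> K then l else 1)" for b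
  define D where "D x = (\<Sum>j\<in>Basis. (c j * (x \<bullet> j)) *\<^sub>R j)" for x :: 'a
  have [measurable]: "D \<in> borel_measurable borel" unfolding D_def by measurable
  have D: "D x \<bullet> b = c b * (x \<bullet> b)" if "b \<in> Basis" for x b
    using that by (simp add: D_def)
  have P: "closest_point S (f x) = (\<Sum>b\<in>K. (x \<bullet> b) *\<^sub>R \<phi> b)" for x
  proof (rule closest_point_coneI[OF CS])
    let ?y = "\<Sum>b\<in>K. (x \<bullet> b) *\<^sub>R \<phi> b"
    show y: "?y \<in> S" using S B(1) by (intro subspace_sum subspace_scale) (auto simp: K_def)
    have "f x - ?y = (\<Sum>b\<in>Basis - K. (x \<bullet> b) *\<^sub>R \<phi> b)"
      unfolding f_def by (subst sum_diff) (auto simp: K_def)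
    moreover have "(\<Sum>b\<in>Basis - K. (x \<bullet> b) *\<^sub>R \<phi> b) \<in> S'"
      using S' B'(1) \<phi>in by (intro subspace_sum subspace_scale) (auto simp: K_def)
    ultimately have o: "(f x - ?y) \<bullet> z = 0" if "z \<in> S" for z
      using that by (auto simp: S'_def orthogonal_def inner_commute)
    show "(f x - ?y) \<bullet> ?y = 0" "\<And>z. z \<in> S \<Longrightarrow> (f x - ?y) \<bullet> z \<le> 0" using o y by auto
  qed
  \<comment> \<open>\<open>D\<close> stretches the coordinates in \<open>K\<close>, which
    \<open>f\<close> sends to \<open>S\<close>. Hence \<open>f\<close> conjugates the diagonal map
    into the dilation along \<open>S\<close>.\<close>
  have fD: "f (D x) = f x + (l - 1) *\<^sub>R closest_point S (f x)" for x
  proof -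
    have "f (D x) = (\<Sum>b\<in>Basis. (x \<bullet> b) *\<^sub>R \<phi> b + (if b \<in> K then ((l - 1) * (x \<bullet> b)) *\<^sub>R \<phi> b else 0))"
      unfolding f_def by (intro sum.cong refl) (auto simp: D c_def algebra_simps)
    also have "\<dots> = f x + (\<Sum>b\<in>Basis \<inter> K. ((l - 1) * (x \<bullet> b)) *\<^sub>R \<phi> b)"
      by (simp add: f_def sum.distrib sum.inter_restrict)
    also have "Basis \<inter> K = K" by (auto simp: K_def)
    finally show ?thesis by (simp add: P scaleR_sum_right)
  qed
  have prodc: "(\<Prod>j\<in>Basis. \<bar>c j\<bar>) = l ^ dim S"
  proof -
    have "(\<Prod>j\<in>Basis. \<bar>c j\<bar>) = (\<Prod>j\<in>Basis. if j \<in> K then l else 1)"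
      using l by (intro prod.cong) (auto simp: c_def)
    also have "\<dots> = (\<Prod>j\<in>Basis \<inter> K. l)" by (rule prod.inter_restrict[symmetric]) simp
    also have "Basis \<inter> K = K" by (auto simp: K_def)
    finally show ?thesis by (simp add: cardK)
  qed
  have lb: "lborel = density (distr lborel borel D) (\<lambda>_. ennreal (l ^ dim S))"
  proof -
    have "lborel = density (distr lborel borel (\<lambda>x. 0 + (\<Sum>j\<in>Basis. (c j * (x \<bullet> j)) *\<^sub>R j)))
        (\<lambda>_. ennreal (\<Prod>j\<in>Basis. \<bar>c j\<bar>))"
      by (rule lborel_affine_euclidean) (use l in \<open>auto simp: c_def\<close>)
    then show ?thesis by (simp add: prodc D_def[abs_def])
  qed
  have "(\<integral>\<^sup>+x. g x \<partial>lborel) = (\<integral>\<^sup>+x. g (f x) \<partial>lborel)"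
    by (rule nn_integral_lborel_orthogonal_transformation[OF f, symmetric]) measurable
  also have "\<dots> = ennreal (l ^ dim S) * (\<integral>\<^sup>+x. g (f (D x)) \<partial>lborel)"
    by (subst lb) (simp add: nn_integral_density nn_integral_distr nn_integral_cmult)
  also have "(\<integral>\<^sup>+x. g (f (D x)) \<partial>lborel) = (\<integral>\<^sup>+x. g (x + (l - 1) *\<^sub>R closest_point S x) \<partial>lborel)"
    unfolding fD
    by (rule nn_integral_lborel_orthogonal_transformation[OF f, of "\<lambda>x. g (x + (l - 1) *\<^sub>R closest_point S x)"]) measurable
  finally show ?thesis .
qed

section \<open>The standard Gaussian measure\<close>

lemma std_gaussian_density_eq:
  "std_gaussian_density (x::'a::euclidean_space) = (1 / sqrt (2 * pi)) ^ DIM('a) * exp (- (norm x)\<^sup>2 / 2)"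
proof -
  have "std_gaussian_density x = (1 / sqrt (2 * pi)) ^ DIM('a) * (\<Prod>b\<in>Basis. exp (- (x \<bullet> b)\<^sup>2 / 2))"
    by (simp add: std_gaussian_density_def std_normal_density_def prod.distrib prod_constant power_one_over prod_dividef)
  also have "(\<Prod>b\<in>Basis. exp (- (x \<bullet> b)\<^sup>2 / 2)) = exp (\<Sum>b\<in>Basis. - (x \<bullet> b)\<^sup>2 / 2)"
    by (simp add: exp_sum)
  also have "(\<Sum>b\<in>Basis. - (x \<bullet> b)\<^sup>2 / 2) = - (norm x)\<^sup>2 / 2"
    by (subst power2_norm_eq_inner, subst euclidean_inner)
       (simp add: sum_divide_distrib sum_negf power2_eq_square)
  finally show ?thesis .
qed

lemma std_gaussian_density_nonneg [simp]: "std_gaussian_density x \<ge> 0"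
  by (simp add: std_gaussian_density_eq)

lemma borel_measurable_std_gaussian_density [measurable]: "std_gaussian_density \<in> borel_measurable borel"
  unfolding std_gaussian_density_def by measurable

lemma sets_std_gaussian [simp, measurable_cong]: "sets std_gaussian = sets borel"
  by (simp add: std_gaussian_def)

lemma space_std_gaussian [simp]: "space std_gaussian = UNIV"
  by (simp add: std_gaussian_def)

lemma nn_integral_std_gaussian:
  "f \<in> borel_measurable borel \<Longrightarrow>
    (\<integral>\<^sup>+x. f x \<partial>std_gaussian) = (\<integral>\<^sup>+x. ennreal (std_gaussian_density x) * f x \<partial>lborel)"
  unfolding std_gaussian_def by (subst nn_integral_density) auto

lemma prob_space_std_gaussian: "prob_space (std_gaussian :: 'a::euclidean_space measure)"
proof
  have "emeasure std_gaussian (space (std_gaussian :: 'a measure))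
      = (\<integral>\<^sup>+x. (\<Prod>b\<in>Basis. ennreal (std_normal_density (x \<bullet> b))) \<partial>(lborel :: 'a measure))"
    by (simp add: std_gaussian_def emeasure_density std_gaussian_density_def prod_ennreal)
  also have "\<dots> = (\<Prod>b\<in>(Basis :: 'a set). (\<integral>\<^sup>+x. ennreal (std_normal_density x) \<partial>lborel))"
    by (rule nn_integral_lborel_prod) auto
  also have "\<dots> = 1" by (simp add: nn_integral_eq_integral)
  finally show "emeasure std_gaussian (space (std_gaussian :: 'a measure)) = 1" .
qed

lemma std_gaussian_second_moment:
  "has_bochner_integral (std_gaussian :: 'a::euclidean_space measure) (\<lambda>x. (norm x)\<^sup>2) (real DIM('a))"
proof (rule has_bochner_integral_nn_integral)
  have coord: "(\<integral>\<^sup>+x. ennreal ((x \<bullet> i)\<^sup>2) \<partial>(std_gaussian :: 'a measure)) = 1" if i: "i \<in> Basis" for i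
  proof -
    \<comment> \<open>The square is absorbed into the factor of coordinate \<open>i\<close>, so that
      the integrand stays a product over coordinates.\<close>
    have "(\<integral>\<^sup>+x. ennreal ((x \<bullet> i)\<^sup>2) \<partial>(std_gaussian :: 'a measure))
      = (\<integral>\<^sup>+x. (\<Prod>b\<in>Basis. ennreal (std_normal_density (x \<bullet> b) * (if b = i then (x \<bullet> b)\<^sup>2 else 1))) \<partial>lborel)"
    proof (subst nn_integral_std_gaussian, simp, intro nn_integral_cong)
      fix x :: 'a
      have "(\<Prod>b\<in>Basis. std_normal_density (x \<bullet> b) * (if b = i then (x \<bullet> b)\<^sup>2 else 1))
          = std_gaussian_density x * (x \<bullet> i)\<^sup>2"
        using i by (simp add: prod.distrib std_gaussian_density_def prod.delta)
      then show "ennreal (std_gaussian_density x) * ennreal ((x \<bullet> i)\<^sup>2)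
        = (\<Prod>b\<in>Basis. ennreal (std_normal_density (x \<bullet> b) * (if b = i then (x \<bullet> b)\<^sup>2 else 1)))"
        by (subst prod_ennreal) (auto simp: ennreal_mult)
    qed
    also have "\<dots> = (\<Prod>b\<in>(Basis :: 'a set). (\<integral>\<^sup>+x. ennreal (std_normal_density x * (if b = i then x\<^sup>2 else 1)) \<partial>lborel))"
      by (rule nn_integral_lborel_prod) auto
    also have "\<dots> = 1"
    proof (rule prod.neutral, intro ballI)
      fix b :: 'a
      have "has_bochner_integral lborel (\<lambda>x. std_normal_density x * x\<^sup>2) 1"
        using std_normal_moment_even[of 1] by simp
      then have "(\<integral>\<^sup>+x. ennreal (std_normal_density x * x\<^sup>2) \<partial>lborel) = 1"
        by (subst nn_integral_eq_integral) (auto simp: has_bochner_integral_iff)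
      then show "(\<integral>\<^sup>+x. ennreal (std_normal_density x * (if b = i then x\<^sup>2 else 1)) \<partial>lborel) = 1"
        by (cases "b = i") (simp_all add: nn_integral_eq_integral)
    qed
    finally show ?thesis .
  qed
  have "(\<integral>\<^sup>+x. ennreal ((norm x)\<^sup>2) \<partial>(std_gaussian :: 'a measure))
      = (\<integral>\<^sup>+x. (\<Sum>i\<in>Basis. ennreal ((x \<bullet> i)\<^sup>2)) \<partial>(std_gaussian :: 'a measure))"
  proof (intro nn_integral_cong)
    fix x :: 'a
    have "(norm x)\<^sup>2 = (\<Sum>i\<in>Basis. (x \<bullet> i)\<^sup>2)"
      unfolding power2_norm_eq_inner by (subst euclidean_inner) (simp add: power2_eq_square)
    then show "ennreal ((norm x)\<^sup>2) = (\<Sum>i\<in>Basis. ennreal ((x \<bullet> i)\<^sup>2))" by (subst sum_ennreal) auto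
  qed
  also have "\<dots> = ennreal (real DIM('a))"
    by (subst nn_integral_sum) (simp_all add: coord ennreal_of_nat_eq_real_of_nat)
  finally show "(\<integral>\<^sup>+x. ennreal ((norm x)\<^sup>2) \<partial>(std_gaussian :: 'a measure)) = ennreal (real DIM('a))" .
qed auto

text \<open>
  With \<open>l\<^sup>2 = 1 + 2 s\<close>, the factor \<open>exp (- s |P x|\<^sup>2)\<close> turns the Gaussian density at \<open>x\<close> into the
  one at \<open>x + (l - 1) P x\<close>, so this is a linear change of variables.
\<close>

lemma std_gaussian_laplace_subspace:
  fixes S :: "'a::euclidean_space set"
  assumes S: "subspace S" and s: "s \<ge> 0" and R [measurable]: "R \<in> sets borel"
    and inv: "\<And>l x. l > 0 \<Longrightarrow> x + (l - 1) *\<^sub>R closest_point S x \<in> R \<longleftrightarrow> x \<in> R"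
  shows "(LINT x:R|std_gaussian. exp (- s * (norm (closest_point S x))\<^sup>2))
    = (1 / sqrt (1 + 2 * s)) ^ dim S * measure std_gaussian R"
proof -
  have CS: "closed_convex_cone S" by (rule subspace_closed_convex_cone[OF S])
  note [measurable] = borel_measurable_closest_point[OF CS]
  interpret prob_space "std_gaussian :: 'a measure" by (rule prob_space_std_gaussian)
  define l where "l = sqrt (1 + 2 * s)"
  have l: "l > 0" "l\<^sup>2 = 1 + 2 * s" using s by (auto simp: l_def)
  let ?P = "closest_point S"
  have key: "std_gaussian_density (x + (l - 1) *\<^sub>R ?P x) = std_gaussian_density x * exp (- s * (norm (?P x))\<^sup>2)" for x :: 'a
  proof -
    have o: "x \<bullet> ?P x = ?P x \<bullet> ?P x" using closest_point_cone(2)[OF CS, of x] by (simp add: inner_diff_left)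
    have "(norm (x + (l - 1) *\<^sub>R ?P x))\<^sup>2 = (norm x)\<^sup>2 + (l\<^sup>2 - 1) * (norm (?P x))\<^sup>2"
      unfolding power2_norm_eq_inner using o
      by (simp add: inner_add_left inner_add_right inner_commute[of "?P x" x] power2_eq_square algebra_simps)
    then have "- (norm (x + (l - 1) *\<^sub>R ?P x))\<^sup>2 / 2 = - (norm x)\<^sup>2 / 2 + - s * (norm (?P x))\<^sup>2"
      by (simp add: l(2))
    then show ?thesis
      unfolding std_gaussian_density_eq by (simp only: exp_add mult.assoc)
  qed
  have "emeasure std_gaussian R = (\<integral>\<^sup>+x. ennreal (std_gaussian_density x) * indicator R x \<partial>lborel)"
    by (simp add: std_gaussian_def emeasure_density)
  also have "\<dots> = ennreal (l ^ dim S) * (\<integral>\<^sup>+x. ennreal (std_gaussian_density (x + (l - 1) *\<^sub>R ?P x))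
        * indicator R (x + (l - 1) *\<^sub>R ?P x) \<partial>lborel)"
    by (rule nn_integral_lborel_subspace_scaling[OF S l(1)]) measurable
  \<comment> \<open>\<open>inv\<close> removes the dilation from the indicator, and
    \<open>key\<close> turns the dilated density into the original one times the Laplace
    factor.\<close>
  also have "(\<integral>\<^sup>+x. ennreal (std_gaussian_density (x + (l - 1) *\<^sub>R ?P x))
        * indicator R (x + (l - 1) *\<^sub>R ?P x) \<partial>lborel)
      = (\<integral>\<^sup>+x. ennreal (indicator R x * exp (- s * (norm (?P x))\<^sup>2)) \<partial>std_gaussian)"
    by (subst nn_integral_std_gaussian)
       (auto intro!: nn_integral_cong simp: key inv[OF l(1)] indicator_def ennreal_mult)
  also have "\<dots> = ennreal (LINT x|std_gaussian. indicator R x * exp (- s * (norm (?P x))\<^sup>2))"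
    using s by (intro nn_integral_eq_integral integrable_const_bound[where B = 1])
      (auto simp: indicator_def)
  finally have "ennreal (measure std_gaussian R)
      = ennreal (l ^ dim S * (LINT x|std_gaussian. indicator R x * exp (- s * (norm (?P x))\<^sup>2)))"
    using l by (simp add: emeasure_eq_measure ennreal_mult')
  then have "measure std_gaussian R = l ^ dim S * (LINT x|std_gaussian. indicator R x * exp (- s * (norm (?P x))\<^sup>2))"
    using l by (subst (asm) ennreal_inj) auto
  then show ?thesis using l unfolding set_lebesgue_integral_def l_def[symmetric]
    by (simp add: field_simps power_divide)
qed

section \<open>Projections onto closed convex cones\<close>

lemma inner_closest_point_cone:
  assumes C: "closed_convex_cone C"
  shows "x \<bullet> closest_point C x = (norm (closest_point C x))\<^sup>2"
  using closest_point_cone(2)[OF C, of x] by (simp add: inner_diff_left power2_norm_eq_inner)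

lemma norm_closest_point_cone_pythagoras:
  assumes C: "closed_convex_cone C"
  shows "(norm (closest_point C x))\<^sup>2 + (norm (x - closest_point C x))\<^sup>2 = (norm x)\<^sup>2"
  using inner_closest_point_cone[OF C, of x] unfolding power2_norm_eq_inner
  by (simp add: inner_diff inner_commute)

lemma norm_closest_point_cone_le:
  assumes C: "closed_convex_cone C"
  shows "norm (closest_point C x) \<le> norm x"
proof (rule power2_le_imp_le)
  show "(norm (closest_point C x))\<^sup>2 \<le> (norm x)\<^sup>2"
    using norm_closest_point_cone_pythagoras[OF C, of x] zero_le_power2[of "norm (x - closest_point C x)"]
    by linarith
qed simp

text \<open>The residual has nonpositive inner product with \<open>y\<close>, so x may be replaced
  by its projection before Cauchy-Schwarz.\<close>

lemma inner_le_norm_closest_point_cone: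
  assumes C: "closed_convex_cone C" and y: "y \<in> C"
  shows "y \<bullet> x \<le> norm (closest_point C x) * norm y"
proof -
  have "y \<bullet> x \<le> closest_point C x \<bullet> y"
    using closest_point_cone(3)[OF C y, of x] by (simp add: inner_diff_left inner_commute[of y])
  also have "\<dots> \<le> norm (closest_point C x) * norm y" by (rule norm_cauchy_schwarz)
  finally show ?thesis .
qed

text \<open>The maximizer is the normalized projection. The clause on unit length is there because
  cones are compared through their sections with the unit sphere; it fails to be available when the
  projection is 0.\<close>

lemma norm_closest_point_cone_attained:
  assumes C: "closed_convex_cone C"
  obtains y where "y \<in> C" "norm y \<le> 1" "y \<bullet> x = norm (closest_point C x)" "closest_point C x \<noteq> 0 \<Longrightarrow> norm y = 1"
proof (cases "closest_point C x = 0")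
  case True
  with that[of 0] closed_convex_coneD(4)[OF C] show ?thesis by simp
next
  case False
  let ?p = "closest_point C x"
  show ?thesis
  proof (rule that[of "(1 / norm ?p) *\<^sub>R ?p"])
    show "(1 / norm ?p) *\<^sub>R ?p \<in> C"
      by (intro closed_convex_coneD(5)[OF C] closest_point_cone(1)[OF C]) simp
    show "((1 / norm ?p) *\<^sub>R ?p) \<bullet> x = norm ?p"
      using inner_closest_point_cone[OF C, of x] False by (simp add: inner_commute power2_eq_square)
  qed (use False in auto)
qed

lemma SUP_inner_cone_cball:
  assumes C: "closed_convex_cone C"
  shows "(SUP y\<in>C \<inter> cball 0 1. y \<bullet> x) = norm (closest_point C x)"
proof (rule cSup_eq_maximum)
  obtain y where "y \<in> C" "norm y \<le> 1" "y \<bullet> x = norm (closest_point C x)"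
    using norm_closest_point_cone_attained[OF C] by metis
  then show "norm (closest_point C x) \<in> (\<lambda>y. y \<bullet> x) ` (C \<inter> cball 0 1)" by force
  fix v assume "v \<in> (\<lambda>y. y \<bullet> x) ` (C \<inter> cball 0 1)"
  then obtain y where "y \<in> C" "norm y \<le> 1" "v = y \<bullet> x" by auto
  then show "v \<le> norm (closest_point C x)"
    using inner_le_norm_closest_point_cone[OF C, of y x] mult_left_le[of "norm y" "norm (closest_point C x)"]
    by simp
qed

text \<open>The length is a maximum of inner products over the unit ball part of the cone, so a
  maximizer for \<open>C\<close> competes in \<open>K\<close>.\<close>

lemma norm_closest_point_cone_mono:
  assumes C: "closed_convex_cone C" and K: "closed_convex_cone K" and "C \<subseteq> K"
  shows "norm (closest_point C x) \<le> norm (closest_point K x)"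
proof -
  obtain y where y: "y \<in> C" "norm y \<le> 1" "y \<bullet> x = norm (closest_point C x)"
    using norm_closest_point_cone_attained[OF C] by metis
  have "y \<bullet> x \<le> norm (closest_point K x) * norm y"
    using y \<open>C \<subseteq> K\<close> by (intro inner_le_norm_closest_point_cone[OF K]) auto
  also have "\<dots> \<le> norm (closest_point K x)" using y by (simp add: mult_left_le)
  finally show ?thesis using y by simp
qed

lemma closest_point_cone_scaleR:
  assumes C: "closed_convex_cone C" and t: "t \<ge> 0"
  shows "closest_point C (t *\<^sub>R x) = t *\<^sub>R closest_point C x"
proof (rule closest_point_coneI[OF C])
  let ?p = "closest_point C x"
  show "t *\<^sub>R ?p \<in> C" by (intro closed_convex_coneD(5)[OF C] closest_point_cone(1)[OF C] t)
  have *: "t *\<^sub>R x - t *\<^sub>R ?p = t *\<^sub>R (x - ?p)" by (simp add: scaleR_diff_right)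
  show "(t *\<^sub>R x - t *\<^sub>R ?p) \<bullet> (t *\<^sub>R ?p) = 0" unfolding * using closest_point_cone(2)[OF C, of x] by simp
  show "(t *\<^sub>R x - t *\<^sub>R ?p) \<bullet> z \<le> 0" if "z \<in> C" for z
    unfolding * using closest_point_cone(3)[OF C that, of x] t by (simp add: mult_nonneg_nonpos)
qed

lemma closed_convex_cone_polar:
  "closed_convex_cone (polar_cone (C :: 'a::euclidean_space set))"
proof (rule closed_convex_coneI)
  have *: "polar_cone C = (\<Inter>x\<in>C. {u. x \<bullet> u \<le> 0})" by (auto simp: polar_cone_def inner_commute)
  show "closed (polar_cone C)" "convex (polar_cone C)"
    unfolding * by (auto intro!: closed_INT convex_INT closed_halfspace_le convex_halfspace_le)
  have "0 \<in> polar_cone C" by (simp add: polar_cone_def)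
  then show "polar_cone C \<noteq> {}" by blast
qed (auto simp: polar_cone_def mult_nonneg_nonpos)

text \<open>Moreau decomposition: the conditions that characterize the projection onto
  \<open>C\<close> become those for the polar cone when projection and residual exchange
  roles.\<close>

lemma closest_point_polar_cone:
  assumes C: "closed_convex_cone C"
  shows "closest_point (polar_cone C) x = x - closest_point C x"
  using closest_point_cone[OF C, where x = x]
  by (intro closest_point_coneI[OF closed_convex_cone_polar]) (auto simp: polar_cone_def inner_commute)

lemma infdist_polar_cone:
  assumes C: "closed_convex_cone C"
  shows "infdist x (polar_cone C) = norm (closest_point C x)"
  using setdist_closest_point[of "polar_cone C" x] closed_convex_coneD(1,3)[OF closed_convex_cone_polar[of C]]
  by (simp add: infdist_eq_setdist closest_point_polar_cone[OF C] dist_norm)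

lemma closed_convex_cone_Times:
  assumes "closed_convex_cone C" "closed_convex_cone K"
  shows "closed_convex_cone (C \<times> K)"
  using closed_convex_coneD[OF assms(1)] closed_convex_coneD[OF assms(2)]
  by (intro closed_convex_coneI closed_Times convex_Times) auto

lemma closest_point_cone_Times:
  assumes C: "closed_convex_cone C" and K: "closed_convex_cone K"
  shows "closest_point (C \<times> K) (x, y) = (closest_point C x, closest_point K y)"
  using closest_point_cone[OF C, where x = x] closest_point_cone[OF K, where x = y]
  by (intro closest_point_coneI[OF closed_convex_cone_Times[OF C K]]) (auto intro!: add_nonpos_nonpos)

lemma closed_convex_cone_orthogonal_image:
  fixes f :: "'a::euclidean_space \<Rightarrow> 'a"
  assumes C: "closed_convex_cone C" and f: "orthogonal_transformation f"
  shows "closed_convex_cone (f ` C)"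
proof (rule closed_convex_coneI)
  have lin: "linear f" by (rule orthogonal_transformation_linear[OF f])
  show "closed (f ` C)" using closed_injective_linear_image closed_convex_coneD(1)[OF C] lin
      orthogonal_transformation_inj[OF f] by blast
  show "convex (f ` C)" using convex_linear_image lin closed_convex_coneD(2)[OF C] by blast
  show "f ` C \<noteq> {}" using closed_convex_coneD(3)[OF C] by blast
  show "t *\<^sub>R x \<in> f ` C" if "x \<in> f ` C" "t > 0" for x t
    using that closed_convex_coneD(5)[OF C] by (auto simp: linear_scale[OF lin, symmetric])
qed

lemma closest_point_orthogonal_image:
  fixes f :: "'a::euclidean_space \<Rightarrow> 'a"
  assumes C: "closed_convex_cone C" and f: "orthogonal_transformation f"
  shows "closest_point (f ` C) (f x) = f (closest_point C x)"
proof (rule closest_point_coneI[OF closed_convex_cone_orthogonal_image[OF C f]])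
  have *: "(f x - f y) \<bullet> f z = (x - y) \<bullet> z" for x y z
    using f by (simp add: orthogonal_transformation_def linear_diff[symmetric])
  show "f (closest_point C x) \<in> f ` C" using closest_point_cone(1)[OF C] by blast
  show "(f x - f (closest_point C x)) \<bullet> f (closest_point C x) = 0"
    unfolding * by (rule closest_point_cone(2)[OF C])
  show "(f x - f (closest_point C x)) \<bullet> z \<le> 0" if "z \<in> f ` C" for z
    using that closest_point_cone(3)[OF C] by (auto simp: *)
qed

section \<open>Convergence of cones\<close>

text \<open>Boundedness makes the supremum in \<open>hausdorff_dist\<close> a genuine upper bound;
  for an unbounded family of reals \<open>SUP\<close> carries no information.\<close>

lemma infdist_le_hausdorff_dist:
  assumes "bounded A" "bounded B" "B \<noteq> {}" "a \<in> A"
  shows "infdist a B \<le> hausdorff_dist A B"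
proof -
  obtain b where b: "b \<in> B" using assms by auto
  obtain e where e: "\<And>x. x \<in> A \<Longrightarrow> dist b x \<le> e" using assms(1) bounded_any_center[of A b] by auto
  have "infdist x B \<le> e" if "x \<in> A" for x
    using e[OF that] infdist_le[OF b, of x] by (simp add: dist_commute)
  then have "bdd_above ((\<lambda>a. infdist a B) ` A)" by (intro bdd_aboveI[of _ e]) auto
  then have "infdist a B \<le> (SUP a\<in>A. infdist a B)" using assms(4) by (rule cSUP_upper[rotated])
  then show ?thesis by (simp add: hausdorff_dist_def)
qed

lemma hausdorff_dist_commute: "hausdorff_dist A B = hausdorff_dist B A"
  by (simp add: hausdorff_dist_def max.commute)

text \<open>A unit maximizer c for \<open>C\<close> has a unit vector d of \<open>D\<close> within
  the Hausdorff distance, and moving from c to d changes the inner product with x by at most |c - d|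
  |x|. If the projection is 0, nonnegativity of the distance suffices.\<close>

lemma norm_closest_point_le_hausdorff_dist:
  fixes C D :: "'a::euclidean_space set"
  assumes C: "closed_convex_cone C" and D: "closed_convex_cone D"
    and ne: "C \<inter> sphere 0 1 \<noteq> {}" "D \<inter> sphere 0 1 \<noteq> {}"
  shows "norm (closest_point C x) \<le> norm (closest_point D x)
    + hausdorff_dist (C \<inter> sphere 0 1) (D \<inter> sphere 0 1) * norm x"
proof -
  let ?C = "C \<inter> sphere 0 1" and ?D = "D \<inter> sphere 0 1"
  have cl: "closed ?D" using closed_convex_coneD(1)[OF D] by (intro closed_Int) auto
  have le: "infdist c ?D \<le> hausdorff_dist ?C ?D" if "c \<in> ?C" for c
    using ne that by (intro infdist_le_hausdorff_dist) (auto intro: bounded_subset[OF bounded_sphere])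
  have main: "c \<bullet> x \<le> norm (closest_point D x) + hausdorff_dist ?C ?D * norm x" if c: "c \<in> ?C" for c
  proof -
    obtain d where d: "d \<in> ?D" "infdist c ?D = dist c d" using infdist_attains_inf[OF cl ne(2)] by metis
    have "c \<bullet> x = d \<bullet> x + (c - d) \<bullet> x" by (simp add: inner_diff_left)
    also have "d \<bullet> x \<le> norm (closest_point D x)"
      using inner_le_norm_closest_point_cone[OF D, of d x] d by simp
    also have "(c - d) \<bullet> x \<le> norm (c - d) * norm x" by (rule norm_cauchy_schwarz)
    also have "\<dots> \<le> hausdorff_dist ?C ?D * norm x"
      using le[OF c] d by (intro mult_right_mono) (auto simp: dist_norm)
    finally show ?thesis by simp
  qed
  obtain c where c: "c \<in> ?C" using ne by blast
  have nn: "hausdorff_dist ?C ?D \<ge> 0" using le[OF c] infdist_nonneg order_trans by blast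
  obtain y where y: "y \<in> C" "y \<bullet> x = norm (closest_point C x)" "closest_point C x \<noteq> 0 \<Longrightarrow> norm y = 1"
    using norm_closest_point_cone_attained[OF C] by metis
  show ?thesis
  proof (cases "closest_point C x = 0")
    case True
    then show ?thesis using nn by simp
  next
    case False
    then show ?thesis using main[of y] y by simp
  qed
qed

lemma norm_closest_point_tendsto:
  fixes C :: "'a::euclidean_space set"
  assumes C: "closed_convex_cone C" and D: "\<And>i. closed_convex_cone (D i)"
    and lim: "(\<lambda>i. conic_hausdorff_dist (D i) C) \<longlonglongrightarrow> 0"
  shows "(\<lambda>i. norm (closest_point (D i) x)) \<longlonglongrightarrow> norm (closest_point C x)"
proof (rule LIM_zero_cancel, rule Lim_null_comparison)
  have zero: "closest_point K x = 0" if "closed_convex_cone K" "K \<inter> sphere 0 1 = {}" for K :: "'a set"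
    using norm_closest_point_cone_attained[OF that(1), of x] that(2) by (metis Int_iff dist_0_norm emptyE mem_sphere)
  \<comment> \<open>The conventional distance 2 excludes, from some index on, that exactly one of
    the two cones is trivial.\<close>
  have "\<forall>\<^sub>F i in sequentially. conic_hausdorff_dist (D i) C < 2"
    using order_tendstoD(2)[OF lim, of 2] by simp
  then show "\<forall>\<^sub>F i in sequentially. norm (norm (closest_point (D i) x) - norm (closest_point C x))
      \<le> conic_hausdorff_dist (D i) C * norm x"
  proof eventually_elim
    case (elim i)
    show ?case
    proof (cases "C \<inter> sphere 0 1 = {} \<or> D i \<inter> sphere 0 1 = {}")
      case True
      then have "C \<inter> sphere 0 1 = {} \<and> D i \<inter> sphere 0 1 = {}"
        using elim by (auto simp: conic_hausdorff_dist_def split: if_splits)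
      then show ?thesis using zero[OF C] zero[OF D] by (simp add: conic_hausdorff_dist_def)
    next
      case False
      then show ?thesis
        using norm_closest_point_le_hausdorff_dist[OF C D[of i], of x]
          norm_closest_point_le_hausdorff_dist[OF D[of i] C, of x]
        by (auto simp: conic_hausdorff_dist_def hausdorff_dist_commute[of "C \<inter> _"] abs_le_iff)
    qed
  qed
  show "(\<lambda>i. conic_hausdorff_dist (D i) C * norm x) \<longlonglongrightarrow> 0"
    using tendsto_mult_left_zero[OF lim] by simp
qed

section \<open>Polyhedral cones\<close>

lemma polyhedral_cone_imp_closed_convex_cone:
  assumes "polyhedral_cone (C :: 'a::euclidean_space set)" shows "closed_convex_cone C"
proof -
  obtain H where H: "C = \<Inter>H" "\<forall>h\<in>H. \<exists>a. a \<noteq> 0 \<and> h = {x. a \<bullet> x \<le> 0}"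
    using assms unfolding polyhedral_cone_def by metis
  have h: "closed h \<and> convex h \<and> 0 \<in> h \<and> (\<forall>x t. x \<in> h \<longrightarrow> t > 0 \<longrightarrow> t *\<^sub>R x \<in> h)" if "h \<in> H" for h
  proof -
    from H(2) that obtain a where "h = {x. a \<bullet> x \<le> 0}" by blast
    then show ?thesis by (auto simp: closed_halfspace_le convex_halfspace_le mult_nonneg_nonpos)
  qed
  have "0 \<in> C" using h H(1) by auto
  show ?thesis
  proof (rule closed_convex_coneI)
    show "closed C" unfolding H(1) using h by (intro closed_Inter) auto
    show "convex C" unfolding H(1) using h by (intro convex_Inter) auto
    show "C \<noteq> {}" using \<open>0 \<in> C\<close> by auto
    show "t *\<^sub>R x \<in> C" if "x \<in> C" "t > 0" for x t using that h unfolding H(1) by auto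
  qed
qed

lemma polyhedral_cone_imp_polyhedron:
  assumes "polyhedral_cone C" shows "polyhedron C"
proof -
  obtain H where "finite H" "C = \<Inter>H" "\<forall>h\<in>H. \<exists>a. a \<noteq> 0 \<and> h = {x. a \<bullet> x \<le> 0}"
    using assms unfolding polyhedral_cone_def by metis
  then show ?thesis unfolding polyhedron_def by (intro exI[of _ H]) blast
qed

text \<open>All right-hand sides \<open>b h\<close> can be lowered to 0: they are nonnegative
  because 0 lies in \<open>C\<close>, and a point with a h . x > 0 would leave the halfspace under a
  large dilation.\<close>

lemma polyhedron_convex_cone_imp_polyhedral_cone:
  fixes C :: "'a::euclidean_space set"
  assumes P: "polyhedron C" and C: "convex_cone C"
  shows "polyhedral_cone C"
proof -
  obtain H where H: "finite H" "C = \<Inter>H" "\<And>h. h \<in> H \<Longrightarrow> \<exists>a b. a \<noteq> 0 \<and> h = {x. a \<bullet> x \<le> b}"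
    using P unfolding polyhedron_def by blast
  then obtain a b where ab: "\<And>h. h \<in> H \<Longrightarrow> a h \<noteq> 0 \<and> h = {x. a h \<bullet> x \<le> b h}" by metis
  let ?H = "(\<lambda>h. {x. a h \<bullet> x \<le> 0}) ` H"
  have mem: "x \<in> C \<longleftrightarrow> (\<forall>h\<in>H. a h \<bullet> x \<le> b h)" for x unfolding H(2) using ab by blast
  have b0: "b h \<ge> 0" if "h \<in> H" for h
    using mem[of 0] convex_cone_contains_0[OF C] that by simp
  have "C = \<Inter>?H"
  proof (intro equalityI subsetI)
    fix x assume "x \<in> \<Inter>?H"
    then have "a h \<bullet> x \<le> b h" if "h \<in> H" for h using b0[OF that] that by force
    then show "x \<in> C" by (simp add: mem)
  next
    fix x assume x: "x \<in> C"
    have "a h \<bullet> x \<le> 0" if h: "h \<in> H" for h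
    proof (rule ccontr)
      assume n: "\<not> a h \<bullet> x \<le> 0"
      \<comment> \<open>With this factor the functional takes the value b h + a h . x, which exceeds
        b h.\<close>
      let ?t = "b h / (a h \<bullet> x) + 1"
      have t: "?t \<ge> 0" using n b0[OF h] by simp
      have "?t *\<^sub>R x \<in> C" using convex_cone_scaleR[OF C t x] .
      then have "?t * (a h \<bullet> x) \<le> b h" using mem h by auto
      then have "a h \<bullet> x * (a h \<bullet> x) \<le> 0" using n by (simp add: field_simps)
      then show False using n mult_pos_pos[of "a h \<bullet> x" "a h \<bullet> x"] by linarith
    qed
    then show "x \<in> \<Inter>?H" by auto
  qed
  moreover have "\<forall>h\<in>?H. \<exists>a. a \<noteq> 0 \<and> h = {x. a \<bullet> x \<le> 0}" using ab by auto
  ultimately show ?thesis unfolding polyhedral_cone_def using H(1) by (intro exI[of _ ?H]) auto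
qed

text \<open>Take the conic hull of a finite e-net of the compact spherical section. It lies inside
  \<open>C\<close>, which settles one half of the Hausdorff distance; the net settles the
  other.\<close>

lemma polyhedral_approximation:
  fixes C :: "'a::euclidean_space set"
  assumes C: "closed_convex_cone C" and ne: "C \<inter> sphere 0 1 \<noteq> {}" and e: "e > 0"
  shows "\<exists>D. polyhedral_cone D \<and> conic_hausdorff_dist D C \<le> e"
proof -
  let ?S = "C \<inter> sphere 0 1"
  have "compact ?S" using closed_convex_coneD(1)[OF C] by (intro closed_Int_compact) auto
  then obtain T where T: "finite T" "T \<subseteq> ?S" "?S \<subseteq> (\<Union>x\<in>T. ball x e)"
    using e compactE_image[of ?S ?S "\<lambda>x. ball x e"] by (metis UN_I centre_in_ball open_ball subsetI)
  let ?D = "convex_cone hull T"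
  have "convex_cone C" using closed_convex_coneD[OF C] by (auto simp: convex_cone_iff)
  then have DC: "?D \<subseteq> C" using T(2) by (intro hull_minimal) auto
  have TD: "T \<subseteq> ?D \<inter> sphere 0 1" using T(2) hull_subset[of T convex_cone] by auto
  have Tne: "T \<noteq> {}" using ne T(3) by auto
  then have Dne: "?D \<inter> sphere 0 1 \<noteq> {}" using TD by auto
  have "hausdorff_dist (?D \<inter> sphere 0 1) ?S \<le> e"
    unfolding hausdorff_dist_def
  proof (intro max.boundedI cSUP_least Dne ne)
    fix x assume "x \<in> ?D \<inter> sphere 0 1"
    then have "infdist x ?S = 0" using DC by (intro infdist_zero) auto
    then show "infdist x ?S \<le> e" using e by simp
  next
    fix x assume "x \<in> ?S"
    then obtain t where t: "t \<in> T" "dist t x < e" using T(3) by auto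
    have "infdist x (?D \<inter> sphere 0 1) \<le> dist x t" using t TD by (intro infdist_le) auto
    then show "infdist x (?D \<inter> sphere 0 1) \<le> e" using t by (simp add: dist_commute)
  qed
  moreover have "polyhedral_cone ?D"
    by (intro polyhedron_convex_cone_imp_polyhedral_cone polyhedron_convex_cone_hull T convex_cone_convex_cone_hull)
  ultimately show ?thesis using ne Dne by (intro exI[of _ ?D]) (simp add: conic_hausdorff_dist_def)
qed

lemma polyhedral_cone_zero: "polyhedral_cone {0 :: 'a::euclidean_space}"
proof (rule polyhedron_convex_cone_imp_polyhedral_cone)
  show "polyhedron {0::'a}" by (intro affine_imp_polyhedron affine_sing)
qed (auto simp: convex_cone_iff)

lemma polyhedral_approximating_sequence:
  fixes C :: "'a::euclidean_space set"
  assumes C: "closed_convex_cone C"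
  obtains D where "\<And>i. polyhedral_cone (D i)" "(\<lambda>i. conic_hausdorff_dist (D i) C) \<longlonglongrightarrow> 0"
proof (cases "C \<inter> sphere 0 1 = {}")
  case True
  have "conic_hausdorff_dist {0} C = 0" using True by (auto simp: conic_hausdorff_dist_def)
  then show ?thesis using that[of "\<lambda>_. {0}"] polyhedral_cone_zero by simp
next
  case False
  have "\<forall>i. \<exists>D. polyhedral_cone D \<and> conic_hausdorff_dist D C \<le> 1 / real (Suc i)"
    using polyhedral_approximation[OF C False] by simp
  then obtain D where D: "\<And>i. polyhedral_cone (D i)" "\<And>i. conic_hausdorff_dist (D i) C \<le> 1 / real (Suc i)"
    by metis
  \<comment> \<open>The lower bound for the squeeze argument; it is derived from a point of the
    section because the distance is built from suprema.\<close>
  have nn: "conic_hausdorff_dist (D i) C \<ge> 0" for i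
  proof (cases "D i \<inter> sphere 0 1 = {}")
    case False
    then obtain d where d: "d \<in> D i \<inter> sphere 0 1" by blast
    have "infdist d (C \<inter> sphere 0 1) \<le> hausdorff_dist (D i \<inter> sphere 0 1) (C \<inter> sphere 0 1)"
      using d \<open>C \<inter> sphere 0 1 \<noteq> {}\<close>
      by (intro infdist_le_hausdorff_dist) (auto intro: bounded_subset[OF bounded_sphere])
    then show ?thesis using infdist_nonneg[of d "C \<inter> sphere 0 1"] False \<open>C \<inter> sphere 0 1 \<noteq> {}\<close>
      by (simp add: conic_hausdorff_dist_def)
  qed (simp add: conic_hausdorff_dist_def)
  have "(\<lambda>i. conic_hausdorff_dist (D i) C) \<longlonglongrightarrow> 0"
    using D(2) nn by (intro tendsto_sandwich[OF _ _ tendsto_const LIMSEQ_Suc[OF lim_1_over_n]] always_eventually) auto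
  then show ?thesis using that D(1) by blast
qed

section \<open>Faces of polyhedral cones\<close>

text \<open>The smallest face containing \<open>x\<close> works: \<open>x\<close> lies in none of
  its facets, since such a facet would be a smaller face of \<open>S\<close>, and the relative
  interior of a polyhedron is what its facets leave over.\<close>

lemma in_rel_interior_face:
  fixes S :: "'a::euclidean_space set"
  assumes S: "polyhedron S" and x: "x \<in> S"
  obtains F where "F face_of S" "x \<in> rel_interior F"
proof -
  let ?A = "{F. F face_of S \<and> x \<in> F}"
  have "S \<in> ?A" using x polyhedron_imp_convex[OF S] by (simp add: face_of_refl)
  then have G: "\<Inter>?A face_of S" by (intro face_of_Inter) auto
  then have "polyhedron (\<Inter>?A)" using face_of_polyhedron_polyhedron[OF S] by blast
  then have r: "rel_interior (\<Inter>?A) = \<Inter>?A - \<Union>{F. F facet_of \<Inter>?A}"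
    by (rule rel_interior_of_polyhedron)
  have "x \<notin> F" if F: "F facet_of \<Inter>?A" for F
  proof
    assume "x \<in> F"
    have f: "F face_of \<Inter>?A" "aff_dim F = aff_dim (\<Inter>?A) - 1" using F by (auto simp: facet_of_def)
    then have "F face_of S" using G face_of_trans by blast
    then have "\<Inter>?A \<subseteq> F" using \<open>x \<in> F\<close> by blast
    then have "F = \<Inter>?A" using face_of_imp_subset[OF f(1)] by blast
    with f(2) show False by simp
  qed
  then have "x \<in> rel_interior (\<Inter>?A)" unfolding r by blast
  with G that show ?thesis by blast
qed

text \<open>For t other than 1 and x nonzero, x is interior to a segment from t x to another
  multiple of x in \<open>C\<close>, so the face property puts t x into \<open>F\<close>. The other
  endpoint is 0 if t > 1 and 2 x if t < 1.\<close>

lemma face_of_closed_convex_cone: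
  fixes C :: "'a::euclidean_space set"
  assumes C: "closed_convex_cone C" and F: "F face_of C" and ne: "F \<noteq> {}"
  shows "closed_convex_cone F"
proof (rule closed_convex_coneI)
  show "closed F" using face_of_imp_closed[OF _ _ F] closed_convex_coneD[OF C] by blast
  show "convex F" by (rule face_of_imp_convex[OF F])
  show "F \<noteq> {}" by (rule ne)
  fix x and t :: real assume x: "x \<in> F" and t: "t > 0"
  have xC: "x \<in> C" using x face_of_imp_subset[OF F] by blast
  have sc: "r *\<^sub>R x \<in> C" if "r \<ge> 0" for r by (rule closed_convex_coneD(5)[OF C xC that])
  have seg: "t *\<^sub>R x \<in> F" if "x \<in> open_segment (t *\<^sub>R x) (r *\<^sub>R x)" "r \<ge> 0" for r
    using F x t that sc[of t] sc[of r] unfolding face_of_def by auto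
  consider "x = 0" | "t = 1" | "x \<noteq> 0" "t > 1" | "x \<noteq> 0" "t < 1" by linarith
  then show "t *\<^sub>R x \<in> F"
  proof cases
    case 3
    then have "x \<in> open_segment (t *\<^sub>R x) (0 *\<^sub>R x)"
      unfolding in_segment by (auto intro!: exI[of _ "1 - 1 / t"])
    then show ?thesis by (rule seg) simp
  next
    case 4
    \<comment> \<open>The solution of (1 - u) t + 2 u = 1.\<close>
    let ?u = "(1 - t) / (2 - t)"
    have "1 - ?u = 1 / (2 - t)" using 4 by (simp add: field_simps)
    then have "(1 - ?u) * t + ?u * 2 = (t + (1 - t) * 2) / (2 - t)"
      by (simp only: add_divide_distrib times_divide_eq_left mult_1)
    then have "(1 - ?u) * t + ?u * 2 = 1" using 4 by simp
    then have "(1 - ?u) *\<^sub>R t *\<^sub>R x + ?u *\<^sub>R 2 *\<^sub>R x = x"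
      by (metis scaleR_add_left scaleR_one scaleR_scaleR)
    moreover have "0 < ?u" "?u < 1" using 4 t by auto
    ultimately have "x \<in> open_segment (t *\<^sub>R x) (2 *\<^sub>R x)"
      unfolding in_segment using 4 by (auto intro!: exI[of _ ?u])
    then show ?thesis by (rule seg) simp
  qed (use x in auto)
qed

text \<open>It is relatively open in the affine hull, hence an open set intersected with a closed
  one.\<close>

lemma borel_rel_interior: "rel_interior (F :: 'a::euclidean_space set) \<in> sets borel"
proof -
  obtain T where "open T" "rel_interior F = affine hull F \<inter> T"
    using openin_rel_interior[of F] by (auto simp: openin_open)
  then show ?thesis by (simp add: borel_open borel_closed closed_affine_hull sets.Int)
qed

text \<open>
  A linear functional attaining its maximum over \<open>F\<close> at a relative interior point is constant on \<open>F\<close>,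
  so the residual \<open>x - \<Pi>\<^sub>C x\<close> is orthogonal to the face containing \<open>\<Pi>\<^sub>C x\<close>.
\<close>

lemma closest_point_span_face:
  fixes C :: "'a::euclidean_space set"
  assumes C: "closed_convex_cone C" and F: "F face_of C" and x: "closest_point C x \<in> rel_interior F"
  shows "closest_point (span F) x = closest_point C x"
proof -
  let ?p = "closest_point C x"
  let ?w = "x - ?p"
  have pF: "?p \<in> F" using x rel_interior_subset by blast
  have FC: "F \<subseteq> C" by (rule face_of_imp_subset[OF F])
  have wF: "?w \<bullet> f = 0" if f: "f \<in> F" for f
  proof -
    \<comment> \<open>The segment from f to the projection can be prolonged beyond it inside
      \<open>F\<close>. The residual is nonpositive on the prolonged point, which forces the
      opposite sign at f.\<close>
    obtain e where e: "e > 1" "(1 - e) *\<^sub>R f + e *\<^sub>R ?p \<in> F"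
      using x f convex_rel_interior_iff[OF face_of_imp_convex[OF F], of ?p] by auto
    have "?w \<bullet> ((1 - e) *\<^sub>R f + e *\<^sub>R ?p) \<le> 0" using e FC by (intro closest_point_cone(3)[OF C]) auto
    then have "(1 - e) * (?w \<bullet> f) \<le> 0"
      using closest_point_cone(2)[OF C, of x] by (simp add: inner_add_right)
    then have "?w \<bullet> f \<ge> 0" using e by (simp add: mult_le_0_iff)
    moreover have "?w \<bullet> f \<le> 0" using closest_point_cone(3)[OF C, of f x] f FC by auto
    ultimately show ?thesis by simp
  qed
  have w: "?w \<bullet> z = 0" if "z \<in> span F" for z
    using orthogonal_to_span[OF that, of ?w] wF by (simp add: orthogonal_def)
  show ?thesis
    using w pF by (intro closest_point_coneI[OF subspace_closed_convex_cone[OF subspace_span]]) (auto simp: span_base)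
qed

lemma closest_point_subspace_scaling:
  fixes S :: "'a::euclidean_space set"
  assumes S: "subspace S"
  shows "closest_point S (x + (l - 1) *\<^sub>R closest_point S x) = l *\<^sub>R closest_point S x"
proof (rule closest_point_coneI[OF subspace_closed_convex_cone[OF S]])
  let ?p = "closest_point S x"
  have p: "?p \<in> S" by (rule closest_point_cone(1)[OF subspace_closed_convex_cone[OF S]])
  then show lp: "l *\<^sub>R ?p \<in> S" by (rule subspace_scale[OF S])
  have *: "x + (l - 1) *\<^sub>R ?p - l *\<^sub>R ?p = x - ?p" by (simp add: algebra_simps)
  show "(x + (l - 1) *\<^sub>R ?p - l *\<^sub>R ?p) \<bullet> (l *\<^sub>R ?p) = 0"
    unfolding * by (rule closest_point_subspace[OF S lp])
  show "(x + (l - 1) *\<^sub>R ?p - l *\<^sub>R ?p) \<bullet> z \<le> 0" if "z \<in> S" for z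
    unfolding * using closest_point_subspace[OF S that, of x] by simp
qed

text \<open>If the projection p lies in the relative interior of \<open>F\<close>, the dilation
  replaces p by l p and keeps the residual, so l p is the new projection; it stays in the relative
  interior because \<open>F\<close> is a cone. The converse is the same fact for 1 / l, which
  inverts the dilation.\<close>

lemma projection_region_scaling:
  fixes C :: "'a::euclidean_space set"
  assumes C: "closed_convex_cone C" and F: "F face_of C" and l: "l > 0"
  shows "closest_point C (x + (l - 1) *\<^sub>R closest_point (span F) x) \<in> rel_interior F
    \<longleftrightarrow> closest_point C x \<in> rel_interior F"
proof -
  let ?T = "\<lambda>l x. x + (l - 1) *\<^sub>R closest_point (span F) x"
  have imp: "closest_point C (?T l x) \<in> rel_interior F"
    if x: "closest_point C x \<in> rel_interior F" and l: "l > 0" for x and l :: real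
  proof -
    let ?p = "closest_point C x"
    have pF: "?p \<in> F" using x rel_interior_subset by blast
    note sp = closest_point_span_face[OF C F x]
    have *: "?T l x - l *\<^sub>R ?p = x - ?p" by (simp add: sp algebra_simps)
    have "closest_point C (?T l x) = l *\<^sub>R ?p"
    proof (rule closest_point_coneI[OF C])
      show "l *\<^sub>R ?p \<in> C" using l by (intro closed_convex_coneD(5)[OF C] closest_point_cone(1)[OF C]) auto
      show "(?T l x - l *\<^sub>R ?p) \<bullet> (l *\<^sub>R ?p) = 0"
        unfolding * using closest_point_cone(2)[OF C, of x] by simp
      show "(?T l x - l *\<^sub>R ?p) \<bullet> z \<le> 0" if "z \<in> C" for z
        unfolding * by (rule closest_point_cone(3)[OF C that])
    qed
    moreover have "l *\<^sub>R ?p \<in> rel_interior F"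
    proof -
      have "closed_convex_cone F" using pF by (intro face_of_closed_convex_cone[OF C F]) auto
      then have "(\<lambda>x. l *\<^sub>R x) ` F = F" using l unfolding closed_convex_cone_def by metis
      then show ?thesis using rel_interior_scaleR[of l F] l x by (metis image_eqI less_irrefl)
    qed
    ultimately show ?thesis by simp
  qed
  have inv: "?T (1 / l) (?T l x) = x"
    unfolding closest_point_subspace_scaling[OF subspace_span] using l by (simp add: algebra_simps)
  show ?thesis using imp[of x l] imp[of "?T l x" "1 / l"] l unfolding inv by auto
qed

section \<open>The Laplace transform of the squared projection length\<close>

definition cone_laplace :: "'a::euclidean_space set \<Rightarrow> real \<Rightarrow> real" where
  "cone_laplace C s = (LINT x|std_gaussian. exp (- s * (norm (closest_point C x))\<^sup>2))"

lemma integrable_cone_laplace: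
  fixes C :: "'a::euclidean_space set"
  assumes C: "closed_convex_cone C" and s: "s \<ge> 0"
  shows "integrable std_gaussian (\<lambda>x. exp (- s * (norm (closest_point C x))\<^sup>2))"
proof -
  interpret prob_space "std_gaussian :: 'a measure" by (rule prob_space_std_gaussian)
  note [measurable] = borel_measurable_closest_point[OF C]
  show ?thesis using s by (intro integrable_const_bound[where B = 1]) auto
qed

lemma cone_laplace_polyhedral:
  fixes C :: "'a::euclidean_space set"
  assumes P: "polyhedral_cone C" and s: "s \<ge> 0"
  shows "cone_laplace C s
    = (\<Sum>k\<le>DIM('a). polyhedral_intrinsic_volume k C * (1 / sqrt (1 + 2 * s)) ^ k)"
proof -
  interpret prob_space "std_gaussian :: 'a measure" by (rule prob_space_std_gaussian)
  have C: "closed_convex_cone C" by (rule polyhedral_cone_imp_closed_convex_cone[OF P])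
  have ph: "polyhedron C" by (rule polyhedral_cone_imp_polyhedron[OF P])
  note [measurable] = borel_measurable_closest_point[OF C]
  \<comment> \<open>The empty face is left out: its affine dimension is -1 and it is not a
    cone.\<close>
  define \<F> where "\<F> = {F. F face_of C \<and> F \<noteq> {}}"
  have fin: "finite \<F>"
    using finite_polyhedron_faces[OF ph] by (rule finite_subset[rotated]) (auto simp: \<F>_def)
  define R where "R F = {x. closest_point C x \<in> rel_interior F}" for F
  have R [measurable]: "R F \<in> sets borel" for F
    using measurable_sets[OF borel_measurable_closest_point[OF C] borel_rel_interior[of F]]
    by (simp add: R_def vimage_def)
  \<comment> \<open>Two faces whose relative interiors meet are equal.\<close>
  have disj: "disjoint_family_on R \<F>"
    unfolding disjoint_family_on_def R_def \<F>_def using face_of_eq by blast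
  have one: "(\<Sum>F\<in>\<F>. indicator (R F) x) = (1::real)" for x
  proof -
    obtain F where F: "F face_of C" "closest_point C x \<in> rel_interior F"
      using in_rel_interior_face[OF ph closest_point_cone(1)[OF C]] by metis
    then have FF: "F \<in> \<F>" "x \<in> R F" by (auto simp: \<F>_def R_def)
    have "(\<Sum>G\<in>\<F>. indicator (R G) x) = (\<Sum>G\<in>\<F>. if G = F then 1 else 0 :: real)"
      using disj FF unfolding disjoint_family_on_def by (intro sum.cong) (auto simp: indicator_def)
    then show ?thesis using fin FF by simp
  qed
  have face: "(LINT x|std_gaussian. indicator (R F) x * exp (- s * (norm (closest_point C x))\<^sup>2))
      = (1 / sqrt (1 + 2 * s)) ^ dim F * measure std_gaussian (R F)" if F: "F \<in> \<F>" for F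
  proof -
    have Ff: "F face_of C" using F by (simp add: \<F>_def)
    have "(LINT x|std_gaussian. indicator (R F) x * exp (- s * (norm (closest_point C x))\<^sup>2))
        = (LINT x:R F|std_gaussian. exp (- s * (norm (closest_point (span F) x))\<^sup>2))"
      unfolding set_lebesgue_integral_def
      by (intro Bochner_Integration.integral_cong)
         (auto simp: indicator_def R_def closest_point_span_face[OF C Ff])
    also have "\<dots> = (1 / sqrt (1 + 2 * s)) ^ dim (span F) * measure std_gaussian (R F)"
      by (intro std_gaussian_laplace_subspace subspace_span s R)
         (simp add: R_def projection_region_scaling[OF C Ff])
    finally show ?thesis by (simp add: dim_span)
  qed
  have int: "integrable std_gaussian (\<lambda>x. indicator (R F) x * exp (- s * (norm (closest_point C x))\<^sup>2))" for F
    using s by (intro integrable_const_bound[where B = 1]) (auto simp: indicator_def)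
  \<comment> \<open>A nonempty face is a cone and contains 0, so the affine dimension in the
    definition is the exponent produced by the change of variables.\<close>
  have adim: "aff_dim F = int (dim F)" if "F \<in> \<F>" for F
    using that closed_convex_coneD(4)[OF face_of_closed_convex_cone[OF C]]
    by (intro aff_dim_zero hull_inc) (auto simp: \<F>_def)
  have pv: "polyhedral_intrinsic_volume k C = (\<Sum>F\<in>{F\<in>\<F>. dim F = k}. measure std_gaussian (R F))" for k
  proof -
    have "F \<in> \<F> \<and> dim F = k" if "F face_of C" "aff_dim F = int k" "closest_point C x \<in> rel_interior F" for F x
    proof -
      have "F \<in> \<F>" using that by (auto simp: \<F>_def)
      with adim[OF this] that show ?thesis by simp
    qed
    then have "{x. \<exists>F. F face_of C \<and> aff_dim F = int k \<and> closest_point C x \<in> rel_interior F}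
        = (\<Union>F\<in>{F\<in>\<F>. dim F = k}. R F)"
      using adim by (auto simp: R_def \<F>_def)
    then show ?thesis unfolding polyhedral_intrinsic_volume_def
      using fin disj by (simp, intro finite_measure_finite_Union) (auto simp: disjoint_family_on_def)
  qed
  have "cone_laplace C s
      = (LINT x|std_gaussian. (\<Sum>F\<in>\<F>. indicator (R F) x) * exp (- s * (norm (closest_point C x))\<^sup>2))"
    by (simp add: one cone_laplace_def)
  also have "\<dots> = (\<Sum>F\<in>\<F>. (1 / sqrt (1 + 2 * s)) ^ dim F * measure std_gaussian (R F))"
    unfolding sum_distrib_right
    by (simp only: Bochner_Integration.integral_sum[OF int] face cong: sum.cong)
  also have "\<dots> = (\<Sum>k\<le>DIM('a). \<Sum>F\<in>{F\<in>\<F>. dim F = k}. (1 / sqrt (1 + 2 * s)) ^ dim F * measure std_gaussian (R F))"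
    by (rule sum.group[symmetric, OF fin]) (auto intro: dim_subset_UNIV)
  also have "\<dots> = (\<Sum>k\<le>DIM('a). polyhedral_intrinsic_volume k C * (1 / sqrt (1 + 2 * s)) ^ k)"
    unfolding pv sum_distrib_right by (intro sum.cong refl) (simp add: mult.commute)
  finally show ?thesis .
qed

lemma cone_laplace_tendsto:
  fixes C :: "'a::euclidean_space set"
  assumes C: "closed_convex_cone C" and D: "\<And>i. closed_convex_cone (D i)"
    and lim: "(\<lambda>i. conic_hausdorff_dist (D i) C) \<longlonglongrightarrow> 0" and s: "s \<ge> 0"
  shows "(\<lambda>i. cone_laplace (D i) s) \<longlonglongrightarrow> cone_laplace C s"
  unfolding cone_laplace_def
proof (rule integral_dominated_convergence[where w = "\<lambda>_. 1"])
  interpret prob_space "std_gaussian :: 'a measure" by (rule prob_space_std_gaussian)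
  note [measurable] = borel_measurable_closest_point[OF C] borel_measurable_closest_point[OF D]
  show "(\<lambda>x. exp (- s * (norm (closest_point C x))\<^sup>2)) \<in> borel_measurable std_gaussian"
    "\<And>i. (\<lambda>x. exp (- s * (norm (closest_point (D i) x))\<^sup>2)) \<in> borel_measurable std_gaussian"
    by measurable
  show "integrable std_gaussian (\<lambda>_::'a. 1::real)" by simp
  show "AE x in std_gaussian. (\<lambda>i. exp (- s * (norm (closest_point (D i) x))\<^sup>2))
      \<longlonglongrightarrow> exp (- s * (norm (closest_point C x))\<^sup>2)"
    by (intro AE_I2 tendsto_intros norm_closest_point_tendsto[OF C D lim])
  show "AE x in std_gaussian. norm (exp (- s * (norm (closest_point (D i) x))\<^sup>2)) \<le> 1" for i
    using s by auto
qed

section \<open>Intrinsic volumes of general cones\<close>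

text \<open>\<open>w k j\<close> is the k-th coefficient of the Lagrange basis polynomial at node
  \<open>z j\<close>: the polynomial with coefficients \<open>c\<close> equals its interpolant, as
  both have degree at most n and agree at n + 1 nodes. What matters is that \<open>w\<close> does
  not depend on \<open>c\<close>.\<close>

lemma vandermonde_inversion:
  fixes z :: "nat \<Rightarrow> real"
  assumes z: "inj_on z {..n}"
  obtains w where "\<And>c k. k \<le> n \<Longrightarrow> c k = (\<Sum>j\<le>n. w k j * (\<Sum>i\<le>n. c i * z j ^ i))"
proof -
  define L where "L j = (\<Prod>m\<in>{..n} - {j}. smult (1 / (z j - z m)) [:- z m, 1:])" for j
  have degL: "degree (L j) \<le> n" if "j \<le> n" for j
  proof -
    have "degree (L j) \<le> (\<Sum>m\<in>{..n} - {j}. degree (smult (1 / (z j - z m)) [:- z m, 1:]))"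
      unfolding L_def by (rule order_trans[OF degree_prod_sum_le]) auto
    also have "\<dots> \<le> (\<Sum>m\<in>{..n} - {j}. 1)" by (intro sum_mono) (auto intro: order_trans[OF degree_smult_le])
    also have "\<dots> = n" using that by simp
    finally show ?thesis .
  qed
  have L: "poly (L j) (z i) = (if i = j then 1 else 0)" if ij: "i \<le> n" "j \<le> n" for i j
  proof (cases "i = j")
    case True
    have "z j - z m \<noteq> 0" if "m \<in> {..n} - {j}" for m
      using inj_onD[OF z, of j m] that ij by auto
    then have "(1 / (z j - z m)) * (z j - z m) = 1" if "m \<in> {..n} - {j}" for m
      using that by simp
    then have "(\<Prod>m\<in>{..n} - {j}. (1 / (z j - z m)) * (z j - z m)) = 1" by (rule prod.neutral[OF ballI])
    moreover have "poly (L j) (z j) = (\<Prod>m\<in>{..n} - {j}. (1 / (z j - z m)) * (z j - z m))"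
      unfolding L_def poly_prod by (intro prod.cong refl) (simp add: right_diff_distrib)
    ultimately show ?thesis using True by simp
  next
    case False
    then show ?thesis using ij by (auto simp: L_def poly_prod intro!: prod_zero bexI[of _ i])
  qed
  have "c k = (\<Sum>j\<le>n. coeff (L j) k * (\<Sum>i\<le>n. c i * z j ^ i))" if k: "k \<le> n" for c k
  proof -
    define p where "p = (\<Sum>i\<le>n. monom (c i) i)"
    define q where "q = (\<Sum>j\<le>n. smult (poly p (z j)) (L j))"
    have pz: "poly p (z j) = (\<Sum>i\<le>n. c i * z j ^ i)" for j
      by (simp add: p_def poly_sum poly_monom)
    have "p = q"
    proof (rule poly_eqI_degree[where A = "z ` {..n}"])
      show "poly p x = poly q x" if "x \<in> z ` {..n}" for x
      proof -
        obtain i where i: "i \<le> n" "x = z i" using \<open>x \<in> z ` {..n}\<close> by blast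
        have "poly q x = (\<Sum>j\<le>n. if j = i then poly p (z j) else 0)"
          unfolding q_def poly_sum by (intro sum.cong) (auto simp: L i)
        then show ?thesis using i by simp
      qed
      have "card (z ` {..n}) = Suc n" using card_image[OF z] by simp
      moreover have "degree p \<le> n" unfolding p_def
        by (intro degree_sum_le) (auto intro: order_trans[OF degree_monom_le])
      moreover have "degree q \<le> n" unfolding q_def
        using degL by (intro degree_sum_le) (auto intro: order_trans[OF degree_smult_le])
      ultimately show "degree p < card (z ` {..n})" "degree q < card (z ` {..n})" by auto
    qed
    moreover have "coeff p k = c k" using k by (simp add: p_def coeff_sum)
    moreover have "coeff q k = (\<Sum>j\<le>n. coeff (L j) k * (\<Sum>i\<le>n. c i * z j ^ i))"
      by (simp add: q_def coeff_sum pz mult.commute)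
    ultimately show ?thesis by simp
  qed
  then show ?thesis using that[of "\<lambda>k j. coeff (L j) k"] by blast
qed

lemma inj_on_laplace_nodes: "inj_on (\<lambda>j. 1 / sqrt (1 + 2 * real j)) A"
  by (auto simp: inj_on_def)

text \<open>
  The intrinsic volumes of a polyhedral cone are the coefficients of a polynomial whose values are
  Laplace transforms; interpolation makes them continuous in the cone.
\<close>

lemma conic_intrinsic_volume_eq:
  obtains w :: "nat \<Rightarrow> nat \<Rightarrow> real"
  where "\<And>(C :: 'a::euclidean_space set) k. closed_convex_cone C \<Longrightarrow> k \<le> DIM('a) \<Longrightarrow>
    conic_intrinsic_volume k C = (\<Sum>j\<le>DIM('a). w k j * cone_laplace C (real j))"
proof -
  define z where "z j = 1 / sqrt (1 + 2 * real j)" for j :: nat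
  have "inj_on z {..DIM('a)}" unfolding z_def by (rule inj_on_laplace_nodes)
  then obtain w where w: "\<And>c k. k \<le> DIM('a) \<Longrightarrow> c k = (\<Sum>j\<le>DIM('a). w k j * (\<Sum>i\<le>DIM('a). c i * z j ^ i))"
    using vandermonde_inversion by metis
  have poly: "polyhedral_intrinsic_volume k C = (\<Sum>j\<le>DIM('a). w k j * cone_laplace C (real j))"
    if "polyhedral_cone C" "k \<le> DIM('a)" for C :: "'a set" and k
    using w[OF that(2), of "\<lambda>k. polyhedral_intrinsic_volume k C"]
    by (simp add: cone_laplace_polyhedral[OF that(1)] z_def)
  have "conic_intrinsic_volume k C = (\<Sum>j\<le>DIM('a). w k j * cone_laplace C (real j))"
    if C: "closed_convex_cone C" and k: "k \<le> DIM('a)" for C :: "'a set" and k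
  proof (cases "polyhedral_cone C")
    case True
    then show ?thesis using poly[OF True k] by (simp add: conic_intrinsic_volume_def)
  next
    case False
    let ?v = "\<Sum>j\<le>DIM('a). w k j * cone_laplace C (real j)"
    have lim: "(\<lambda>i. polyhedral_intrinsic_volume k (D i)) \<longlonglongrightarrow> ?v"
      if D: "\<forall>i. polyhedral_cone (D i)" "(\<lambda>i. conic_hausdorff_dist (D i) C) \<longlonglongrightarrow> 0" for D
    proof -
      have "polyhedral_intrinsic_volume k (D i) = (\<Sum>j\<le>DIM('a). w k j * cone_laplace (D i) (real j))" for i
        using D poly k by blast
      moreover have "(\<lambda>i. \<Sum>j\<le>DIM('a). w k j * cone_laplace (D i) (real j)) \<longlonglongrightarrow> ?v"
        using D by (intro tendsto_sum tendsto_mult tendsto_const cone_laplace_tendsto[OF C])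
          (auto intro: polyhedral_cone_imp_closed_convex_cone)
      ultimately show ?thesis by simp
    qed
    obtain D where D: "\<And>i. polyhedral_cone (D i)" "(\<lambda>i. conic_hausdorff_dist (D i) C) \<longlonglongrightarrow> 0"
      using polyhedral_approximating_sequence[OF C] by blast
    have "(THE v. \<forall>D :: nat \<Rightarrow> 'a set.
              (\<forall>i. polyhedral_cone (D i)) \<and> (\<lambda>i. conic_hausdorff_dist (D i) C) \<longlonglongrightarrow> 0
              \<longrightarrow> (\<lambda>i. polyhedral_intrinsic_volume k (D i)) \<longlonglongrightarrow> v) = ?v"
    \<comment> \<open>Uniqueness uses that an approximating sequence exists; otherwise every v would
      satisfy the condition vacuously.\<close>
    proof (rule the_equality)
      fix v assume "\<forall>D :: nat \<Rightarrow> 'a set.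
              (\<forall>i. polyhedral_cone (D i)) \<and> (\<lambda>i. conic_hausdorff_dist (D i) C) \<longlonglongrightarrow> 0
              \<longrightarrow> (\<lambda>i. polyhedral_intrinsic_volume k (D i)) \<longlonglongrightarrow> v"
      then have "(\<lambda>i. polyhedral_intrinsic_volume k (D i)) \<longlonglongrightarrow> v" using D by blast
      then show "v = ?v" using lim[of D] D LIMSEQ_unique by blast
    qed (use lim in blast)
    then show ?thesis using False by (simp add: conic_intrinsic_volume_def)
  qed
  with that show ?thesis by blast
qed

text \<open>The weights involve the transform only at the nodes 0, ..., d. For other
  \<open>s\<close> the polyhedral identity is passed to the limit along approximants, now that the
  volumes themselves are known to converge.\<close>

lemma cone_laplace_eq_intrinsic_volumes:
  fixes C :: "'a::euclidean_space set"
  assumes C: "closed_convex_cone C" and s: "s \<ge> 0"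
  shows "cone_laplace C s = (\<Sum>k\<le>DIM('a). conic_intrinsic_volume k C * (1 / sqrt (1 + 2 * s)) ^ k)"
proof -
  obtain D where D: "\<And>i. polyhedral_cone (D i)" "(\<lambda>i. conic_hausdorff_dist (D i) C) \<longlonglongrightarrow> 0"
    using polyhedral_approximating_sequence[OF C] by blast
  have DC: "closed_convex_cone (D i)" for i by (rule polyhedral_cone_imp_closed_convex_cone[OF D(1)])
  obtain w :: "nat \<Rightarrow> nat \<Rightarrow> real"
    where w: "\<And>(C :: 'a set) k. closed_convex_cone C \<Longrightarrow> k \<le> DIM('a) \<Longrightarrow>
      conic_intrinsic_volume k C = (\<Sum>j\<le>DIM('a). w k j * cone_laplace C (real j))"
    using conic_intrinsic_volume_eq by metis
  have vol: "(\<lambda>i. conic_intrinsic_volume k (D i)) \<longlonglongrightarrow> conic_intrinsic_volume k C" if "k \<le> DIM('a)" for k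
    unfolding w[OF C that] w[OF DC that]
    by (intro tendsto_sum tendsto_mult tendsto_const cone_laplace_tendsto[OF C DC D(2)]) simp
  have "(\<lambda>i. \<Sum>k\<le>DIM('a). conic_intrinsic_volume k (D i) * (1 / sqrt (1 + 2 * s)) ^ k)
      \<longlonglongrightarrow> (\<Sum>k\<le>DIM('a). conic_intrinsic_volume k C * (1 / sqrt (1 + 2 * s)) ^ k)"
    by (intro tendsto_sum tendsto_mult tendsto_const vol) simp
  then have "(\<lambda>i. cone_laplace (D i) s) \<longlonglongrightarrow> (\<Sum>k\<le>DIM('a). conic_intrinsic_volume k C * (1 / sqrt (1 + 2 * s)) ^ k)"
    using D(1) by (simp add: cone_laplace_polyhedral[OF D(1) s] conic_intrinsic_volume_def)
  then show ?thesis using cone_laplace_tendsto[OF C DC D(2) s] LIMSEQ_unique by blast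
qed

text \<open>Compare the derivatives at \<open>s = 0\<close> of both sides of the preceding identity.\<close>

lemma statistical_dimension_std_gaussian:
  fixes C :: "'a::euclidean_space set"
  assumes C: "closed_convex_cone C"
  shows "has_bochner_integral std_gaussian (\<lambda>x. (norm (closest_point C x))\<^sup>2) (statistical_dimension C)"
proof -
  interpret prob_space "std_gaussian :: 'a measure" by (rule prob_space_std_gaussian)
  note [measurable] = borel_measurable_closest_point[OF C]
  let ?q = "\<lambda>x. (norm (closest_point C x))\<^sup>2"
  have int2: "integrable std_gaussian (\<lambda>x::'a. (norm x)\<^sup>2)"
    using std_gaussian_second_moment has_bochner_integral_iff by blast
  have int: "integrable std_gaussian ?q"
    by (rule Bochner_Integration.integrable_bound[OF int2])
       (auto intro!: power_mono norm_closest_point_cone_le[OF C])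
  define s where "s n = 1 / real (Suc n)" for n
  have s: "s n > 0" for n by (simp add: s_def)
  have "s \<longlonglongrightarrow> 0" unfolding s_def by (rule LIMSEQ_Suc[OF lim_1_over_n])
  then have s0: "filterlim s (at 0) sequentially"
    using s by (auto simp: filterlim_at intro!: always_eventually) (metis less_irrefl)
  \<comment> \<open>Used twice: on the integrand at a fixed point, and on each power of 1 / sqrt (1
    + 2 s).\<close>
  have quot: "(\<lambda>n. (1 - f (s n)) / s n) \<longlonglongrightarrow> - D"
    if "(f has_real_derivative D) (at 0)" "f 0 = 1" for f :: "real \<Rightarrow> real" and D
  proof -
    have "(\<lambda>n. (f (0 + s n) - f 0) / s n) \<longlonglongrightarrow> D"
      using filterlim_compose[OF _ s0] that(1) by (auto simp: DERIV_def)
    then have "(\<lambda>n. - ((f (s n) - 1) / s n)) \<longlonglongrightarrow> - D" using that(2) by (intro tendsto_minus) simp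
    then show ?thesis by (simp add: minus_divide_left)
  qed
  have "(\<lambda>n. LINT x|std_gaussian. (1 - exp (- s n * ?q x)) / s n) \<longlonglongrightarrow> (LINT x|std_gaussian. ?q x)"
  proof (rule integral_dominated_convergence[where w = ?q])
    show "?q \<in> borel_measurable std_gaussian"
      "\<And>n. (\<lambda>x. (1 - exp (- s n * ?q x)) / s n) \<in> borel_measurable std_gaussian" by measurable
    show "integrable std_gaussian ?q" by (rule int)
    show "AE x in std_gaussian. (\<lambda>n. (1 - exp (- s n * ?q x)) / s n) \<longlonglongrightarrow> ?q x"
    proof (rule AE_I2)
      fix x
      have "((\<lambda>s. exp (- s * ?q x)) has_real_derivative - ?q x) (at 0)"
        by (auto intro!: derivative_eq_intros)
      from quot[OF this] show "(\<lambda>n. (1 - exp (- s n * ?q x)) / s n) \<longlonglongrightarrow> ?q x" by simp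
    qed
    \<comment> \<open>From 0 <= 1 - exp (-u) <= u for u >= 0: the limit function itself dominates
      the difference quotients.\<close>
    show "AE x in std_gaussian. norm ((1 - exp (- s n * ?q x)) / s n) \<le> ?q x" for n
    proof (rule AE_I2)
      fix x
      have "1 - exp (- s n * ?q x) \<le> s n * ?q x" using exp_ge_add_one_self[of "- s n * ?q x"] by simp
      moreover have "exp (- s n * ?q x) \<le> 1" using s[of n] by simp
      ultimately show "norm ((1 - exp (- s n * ?q x)) / s n) \<le> ?q x"
        using s[of n] by (simp add: field_simps)
    qed
  qed
  moreover have "(LINT x|std_gaussian. (1 - exp (- s n * ?q x)) / s n)
      = (\<Sum>k\<le>DIM('a). conic_intrinsic_volume k C * ((1 - (1 / sqrt (1 + 2 * s n)) ^ k) / s n))" for n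
  proof -
    \<comment> \<open>The identity at s = 0, where the transform has value 1.\<close>
    have 1: "(\<Sum>k\<le>DIM('a). conic_intrinsic_volume k C) = 1"
      using cone_laplace_eq_intrinsic_volumes[OF C, of 0] by (simp add: cone_laplace_def prob_space[simplified])
    have "(LINT x|std_gaussian. (1 - exp (- s n * ?q x)) / s n) = (1 - cone_laplace C (s n)) / s n"
      using integrable_cone_laplace[OF C, of "s n"] s[of n]
      by (simp add: cone_laplace_def prob_space[simplified])
    also have "\<dots> = ((\<Sum>k\<le>DIM('a). conic_intrinsic_volume k C)
        - (\<Sum>k\<le>DIM('a). conic_intrinsic_volume k C * (1 / sqrt (1 + 2 * s n)) ^ k)) / s n"
      using s[of n] by (simp add: 1 cone_laplace_eq_intrinsic_volumes[OF C])
    also have "\<dots> = (\<Sum>k\<le>DIM('a). conic_intrinsic_volume k C * ((1 - (1 / sqrt (1 + 2 * s n)) ^ k) / s n))"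
      by (simp add: sum_subtractf[symmetric] sum_divide_distrib right_diff_distrib)
    finally show ?thesis .
  qed
  moreover have "(\<lambda>n. \<Sum>k\<le>DIM('a). conic_intrinsic_volume k C * ((1 - (1 / sqrt (1 + 2 * s n)) ^ k) / s n))
      \<longlonglongrightarrow> (\<Sum>k\<le>DIM('a). conic_intrinsic_volume k C * real k)"
  proof (intro tendsto_sum tendsto_mult tendsto_const)
    fix k
    have "((\<lambda>s. (1 / sqrt (1 + 2 * s)) ^ k) has_real_derivative - real k) (at 0)"
      by (auto intro!: derivative_eq_intros simp: field_simps)
    from quot[OF this] show "(\<lambda>n. (1 - (1 / sqrt (1 + 2 * s n)) ^ k) / s n) \<longlonglongrightarrow> real k" by simp
  qed
  ultimately have "(LINT x|std_gaussian. ?q x) = (\<Sum>k\<le>DIM('a). conic_intrinsic_volume k C * real k)"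
    using LIMSEQ_unique by auto
  also have "\<dots> = statistical_dimension C"
    by (simp add: statistical_dimension_def mult.commute atMost_atLeast0)
  finally show ?thesis using int by (simp add: has_bochner_integral_iff)
qed

section \<open>Properties of the statistical dimension\<close>

text \<open>With the whole space as region, the transform is the single power with exponent dim L.
  Since the node values determine the coefficients, the intrinsic volumes are concentrated at k =
  dim L.\<close>

lemma statistical_dimension_subspace:
  fixes L :: "'a::euclidean_space set"
  assumes L: "subspace L"
  shows "statistical_dimension L = real (dim L)"
proof -
  interpret prob_space "std_gaussian :: 'a measure" by (rule prob_space_std_gaussian)
  let ?z = "\<lambda>j. 1 / sqrt (1 + 2 * real j)"
  have CL: "closed_convex_cone L" by (rule subspace_closed_convex_cone[OF L])
  have dimL: "dim L \<le> DIM('a)" by (rule dim_subset_UNIV)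
  obtain w where w: "\<And>c k. k \<le> DIM('a) \<Longrightarrow> c k = (\<Sum>j\<le>DIM('a). w k j * (\<Sum>i\<le>DIM('a). c i * ?z j ^ i))"
    by (rule vandermonde_inversion[OF inj_on_laplace_nodes, of "DIM('a)"]) blast
  have "(\<Sum>i\<le>DIM('a). conic_intrinsic_volume i L * ?z j ^ i) = (\<Sum>i\<le>DIM('a). of_bool (i = dim L) * ?z j ^ i)" for j
  proof -
    have "(\<Sum>i\<le>DIM('a). conic_intrinsic_volume i L * ?z j ^ i) = cone_laplace L (real j)"
      by (simp add: cone_laplace_eq_intrinsic_volumes[OF CL])
    also have "\<dots> = ?z j ^ dim L"
      using std_gaussian_laplace_subspace[OF L, of "real j" UNIV] prob_space
      by (simp add: cone_laplace_def set_lebesgue_integral_def)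
    also have "\<dots> = (\<Sum>i\<le>DIM('a). if i = dim L then ?z j ^ i else 0)" using dimL by simp
    also have "\<dots> = (\<Sum>i\<le>DIM('a). of_bool (i = dim L) * ?z j ^ i)" by (intro sum.cong) auto
    finally show ?thesis .
  qed
  then have "conic_intrinsic_volume k L = of_bool (k = dim L)" if "k \<le> DIM('a)" for k
    using w[OF that, of "\<lambda>k. conic_intrinsic_volume k L"] w[OF that, of "\<lambda>k. of_bool (k = dim L)"] by simp
  then have "statistical_dimension L = (\<Sum>k=0..DIM('a). if k = dim L then real k else 0)"
    unfolding statistical_dimension_def by (intro sum.cong) auto
  then show ?thesis using dimL by simp
qed

lemma statistical_dimension_eq:
  "closed_convex_cone C \<Longrightarrow> statistical_dimension C = (LINT x|std_gaussian. (norm (closest_point C x))\<^sup>2)"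
  using statistical_dimension_std_gaussian has_bochner_integral_integral_eq by metis

lemma integrable_norm_closest_point_sq:
  "closed_convex_cone C \<Longrightarrow> integrable std_gaussian (\<lambda>x. (norm (closest_point C x))\<^sup>2)"
  using statistical_dimension_std_gaussian has_bochner_integral_iff by metis

lemma nn_integral_statistical_dimension:
  "closed_convex_cone C \<Longrightarrow>
    (\<integral>\<^sup>+x. ennreal ((norm (closest_point C x))\<^sup>2) \<partial>std_gaussian) = ennreal (statistical_dimension C)"
  by (subst nn_integral_eq_integral[OF integrable_norm_closest_point_sq])
     (simp_all add: statistical_dimension_eq)

lemma statistical_dimension_nonneg: "closed_convex_cone C \<Longrightarrow> statistical_dimension C \<ge> 0"
  by (simp add: statistical_dimension_eq)

lemma statistical_dimension_mono:
  assumes C: "closed_convex_cone C" and K: "closed_convex_cone K" and "C \<subseteq> K"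
  shows "statistical_dimension C \<le> statistical_dimension K"
  unfolding statistical_dimension_eq[OF C] statistical_dimension_eq[OF K]
  by (intro integral_mono integrable_norm_closest_point_sq C K power_mono
      norm_closest_point_cone_mono[OF C K \<open>C \<subseteq> K\<close>]) simp

lemma statistical_dimension_polar:
  fixes C :: "'a::euclidean_space set"
  assumes C: "closed_convex_cone C"
  shows "statistical_dimension C + statistical_dimension (polar_cone C) = real DIM('a)"
proof -
  have "statistical_dimension C + statistical_dimension (polar_cone C)
      = (LINT x|std_gaussian. (norm (closest_point C x))\<^sup>2 + (norm (closest_point (polar_cone C) x))\<^sup>2)"
    using C closed_convex_cone_polar[of C]
    by (simp add: statistical_dimension_eq integrable_norm_closest_point_sq)
  also have "\<dots> = (LINT x|(std_gaussian :: 'a measure). (norm x)\<^sup>2)"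
    by (simp add: closest_point_polar_cone[OF C] norm_closest_point_cone_pythagoras[OF C])
  also have "\<dots> = real DIM('a)"
    by (rule has_bochner_integral_integral_eq[OF std_gaussian_second_moment])
  finally show ?thesis .
qed

section \<open>Rotation invariance and product structure of the Gaussian measure\<close>

lemma distr_std_gaussian_orthogonal_transformation:
  fixes f :: "'a::euclidean_space \<Rightarrow> 'a"
  assumes f: "orthogonal_transformation f"
  shows "distr std_gaussian borel f = std_gaussian"
proof (rule measure_eqI)
  have [measurable]: "f \<in> borel \<rightarrow>\<^sub>M borel"
    by (intro borel_measurable_continuous_onI linear_continuous_on linear_conv_bounded_linear[THEN iffD1]
        orthogonal_transformation_linear f)
  fix A :: "'a set" assume "A \<in> sets (distr std_gaussian borel f)"
  then have [measurable]: "A \<in> sets borel" by simp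
  have "emeasure (distr std_gaussian borel f) A = (\<integral>\<^sup>+x. indicator A (f x) \<partial>std_gaussian)"
    by (simp flip: nn_integral_indicator add: nn_integral_distr)
  also have "\<dots> = (\<integral>\<^sup>+x. ennreal (std_gaussian_density (f x)) * indicator A (f x) \<partial>lborel)"
    by (simp add: nn_integral_std_gaussian std_gaussian_density_eq orthogonal_transformation_norm[OF f])
  also have "\<dots> = (\<integral>\<^sup>+x. ennreal (std_gaussian_density x) * indicator A x \<partial>lborel)"
    by (rule nn_integral_lborel_orthogonal_transformation[OF f]) measurable
  also have "\<dots> = emeasure std_gaussian A"
    by (simp add: std_gaussian_def emeasure_density)
  finally show "emeasure (distr std_gaussian borel f) A = emeasure std_gaussian A" .
qed simp

lemma statistical_dimension_orthogonal_image:
  fixes f :: "'a::euclidean_space \<Rightarrow> 'a"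
  assumes C: "closed_convex_cone C" and f: "orthogonal_transformation f"
  shows "statistical_dimension (f ` C) = statistical_dimension C"
proof -
  have [measurable]: "f \<in> borel \<rightarrow>\<^sub>M borel"
    by (intro borel_measurable_continuous_onI linear_continuous_on linear_conv_bounded_linear[THEN iffD1]
        orthogonal_transformation_linear f)
  have fC: "closed_convex_cone (f ` C)" by (rule closed_convex_cone_orthogonal_image[OF C f])
  note [measurable] = borel_measurable_closest_point[OF fC]
  have "statistical_dimension (f ` C)
      = (LINT x|distr std_gaussian borel f. (norm (closest_point (f ` C) x))\<^sup>2)"
    by (simp add: statistical_dimension_eq[OF fC] distr_std_gaussian_orthogonal_transformation[OF f])
  also have "\<dots> = (LINT x|std_gaussian. (norm (closest_point (f ` C) (f x)))\<^sup>2)"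
    by (rule integral_distr) measurable
  also have "\<dots> = statistical_dimension C"
    by (simp add: closest_point_orthogonal_image[OF C f] orthogonal_transformation_norm[OF f] statistical_dimension_eq[OF C])
  finally show ?thesis .
qed

lemma std_gaussian_Times:
  "(std_gaussian :: ('a::euclidean_space \<times> 'b::euclidean_space) measure) = std_gaussian \<Otimes>\<^sub>M std_gaussian"
proof -
  interpret B: prob_space "std_gaussian :: 'b measure" by (rule prob_space_std_gaussian)
  have "(std_gaussian :: 'a measure) \<Otimes>\<^sub>M (std_gaussian :: 'b measure)
      = density (lborel \<Otimes>\<^sub>M lborel) (\<lambda>(x, y). ennreal (std_gaussian_density x) * ennreal (std_gaussian_density y))"
    unfolding std_gaussian_def
    by (rule pair_measure_density)
       (auto simp: std_gaussian_def[symmetric] B.sigma_finite_measure_axioms sigma_finite_lborel)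
  also have "\<dots> = density lborel (\<lambda>p. ennreal (std_gaussian_density p))"
    unfolding lborel_prod
    by (intro arg_cong[where f = "density lborel"] ext)
       (auto simp: std_gaussian_density_eq norm_Pair power_add ennreal_mult[symmetric] add_divide_distrib exp_add[symmetric])
  finally show ?thesis by (simp add: std_gaussian_def)
qed

text \<open>The projection acts componentwise and the squared norm of a pair is additive. The
  computation runs in \<open>ennreal\<close> so that Tonelli applies directly; nonnegativity brings
  it back to the reals.\<close>

lemma statistical_dimension_Times:
  fixes C :: "'a::euclidean_space set" and K :: "'b::euclidean_space set"
  assumes C: "closed_convex_cone C" and K: "closed_convex_cone K"
  shows "statistical_dimension (C \<times> K) = statistical_dimension C + statistical_dimension K"
proof -
  interpret A: prob_space "std_gaussian :: 'a measure" by (rule prob_space_std_gaussian)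
  interpret B: prob_space "std_gaussian :: 'b measure" by (rule prob_space_std_gaussian)
  note [measurable] = borel_measurable_closest_point[OF C] borel_measurable_closest_point[OF K]
  let ?f = "\<lambda>x. ennreal ((norm (closest_point C x))\<^sup>2)" and ?g = "\<lambda>y. ennreal ((norm (closest_point K y))\<^sup>2)"
  have "ennreal (statistical_dimension (C \<times> K))
      = (\<integral>\<^sup>+p. ?f (fst p) + ?g (snd p) \<partial>(std_gaussian \<Otimes>\<^sub>M std_gaussian))"
    unfolding nn_integral_statistical_dimension[OF closed_convex_cone_Times[OF C K], symmetric] std_gaussian_Times
    by (intro nn_integral_cong) (auto simp: closest_point_cone_Times[OF C K] norm_Pair)
  also have "\<dots> = (\<integral>\<^sup>+x. \<integral>\<^sup>+y. ?f x + ?g y \<partial>std_gaussian \<partial>std_gaussian)"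
    by (subst B.nn_integral_fst[symmetric]) auto
  also have "\<dots> = (\<integral>\<^sup>+x. ?f x + ennreal (statistical_dimension K) \<partial>std_gaussian)"
    by (simp add: nn_integral_add nn_integral_statistical_dimension[OF K] B.emeasure_space_1[simplified])
  also have "\<dots> = ennreal (statistical_dimension C) + ennreal (statistical_dimension K)"
    by (simp add: nn_integral_add nn_integral_statistical_dimension[OF C] A.emeasure_space_1[simplified])
  finally show ?thesis
    using statistical_dimension_nonneg[OF C] statistical_dimension_nonneg[OF K]
      statistical_dimension_nonneg[OF closed_convex_cone_Times[OF C K]]
    by (simp flip: ennreal_plus)
qed

section \<open>The spherical formulation\<close>

text \<open>Layer cake: \<open>W (norm x)\<close> integrates \<open>w\<close> over all radii t whose
  ball contains x. After Tonelli, homogeneity of \<open>h\<close> makes its integral over the ball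
  of radius t equal to t^d times that over the unit ball. The \<open>max\<close> accounts for the
  empty balls of negative radius.\<close>

lemma nn_integral_radial:
  fixes h :: "'a::euclidean_space \<Rightarrow> ennreal" and w :: "real \<Rightarrow> ennreal"
  assumes [measurable]: "h \<in> borel_measurable borel" "w \<in> borel_measurable borel"
    and h: "\<And>t x. t > 0 \<Longrightarrow> h (t *\<^sub>R x) = h x"
    and W: "\<And>r. r \<ge> 0 \<Longrightarrow> W r = (\<integral>\<^sup>+t. w t * indicator {r..} t \<partial>lborel)"
  shows "(\<integral>\<^sup>+x. h x * W (norm x) \<partial>lborel)
    = (\<integral>\<^sup>+t. w t * ennreal (max 0 t ^ DIM('a)) \<partial>lborel) * (\<integral>\<^sup>+x. h x * indicator (cball 0 1) x \<partial>lborel)"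
proof -
  let ?A = "\<integral>\<^sup>+x. h x * indicator (cball 0 1) x \<partial>lborel"
  have ball: "(\<integral>\<^sup>+x. h x * of_bool (norm x \<le> t) \<partial>lborel) = ennreal (max 0 t ^ DIM('a)) * ?A" for t
  proof -
    consider "t < 0" | "t = 0" | "t > 0" by linarith
    then show ?thesis
    proof cases
      case 1
      then have "\<not> norm x \<le> t" for x :: 'a using norm_ge_zero[of x] by linarith
      then show ?thesis using 1 by (simp add: power_0_left)
    next
      case 2
      have "AE x in lborel. h x * of_bool (norm x \<le> t) = 0"
        using AE_lborel_singleton[of "0::'a"] by eventually_elim (use 2 in auto)
      then show ?thesis using 2 by (simp add: nn_integral_0_iff_AE power_0_left)
    next
      case 3
      have "(\<integral>\<^sup>+x. h x * of_bool (norm x \<le> t) \<partial>lborel)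
          = ennreal (t ^ DIM('a)) * (\<integral>\<^sup>+x. h (0 + t *\<^sub>R x) * of_bool (norm (0 + t *\<^sub>R x) \<le> t) \<partial>lborel)"
        using nn_integral_lborel_homothety[where c = t and t = 0 and f = "\<lambda>x. h x * of_bool (norm x \<le> t)"] 3
        by simp
      also have "(\<integral>\<^sup>+x. h (0 + t *\<^sub>R x) * of_bool (norm (0 + t *\<^sub>R x) \<le> t) \<partial>lborel) = ?A"
        using 3 by (intro nn_integral_cong) (auto simp: h indicator_def)
      finally show ?thesis using 3 by simp
    qed
  qed
  have "(\<integral>\<^sup>+x. h x * W (norm x) \<partial>lborel)
      = (\<integral>\<^sup>+x. \<integral>\<^sup>+t. w t * (h x * of_bool (norm x \<le> t)) \<partial>lborel \<partial>lborel)"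
  proof (intro nn_integral_cong)
    fix x :: 'a
    have "h x * W (norm x) = (\<integral>\<^sup>+t. h x * (w t * indicator {norm x..} t) \<partial>lborel)"
      by (simp add: W nn_integral_cmult)
    also have "\<dots> = (\<integral>\<^sup>+t. w t * (h x * of_bool (norm x \<le> t)) \<partial>lborel)"
      by (intro nn_integral_cong) (auto simp: indicator_def mult_ac)
    finally show "h x * W (norm x) = (\<integral>\<^sup>+t. w t * (h x * of_bool (norm x \<le> t)) \<partial>lborel)" .
  qed
  also have "\<dots> = (\<integral>\<^sup>+t. \<integral>\<^sup>+x. w t * (h x * of_bool (norm x \<le> t)) \<partial>lborel \<partial>lborel)"
    by (rule lborel_pair.Fubini') measurable
  also have "\<dots> = (\<integral>\<^sup>+t. w t * ennreal (max 0 t ^ DIM('a)) * ?A \<partial>lborel)"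
    by (intro nn_integral_cong) (simp add: nn_integral_cmult ball mult.assoc)
  finally show ?thesis by (simp add: nn_integral_multc)
qed

text \<open>Direction and length of a Gaussian vector are independent. The derivative hypothesis
  presents u(r) exp (-r^2 / 2) as the tail integral of the nonnegative \<open>v\<close>, the form
  that layer cake requires.\<close>

lemma std_gaussian_homogeneous:
  fixes h :: "'a::euclidean_space \<Rightarrow> real" and u v :: "real \<Rightarrow> real"
  assumes [measurable]: "h \<in> borel_measurable borel" "u \<in> borel_measurable borel" "v \<in> borel_measurable borel"
    and h: "\<And>t x. t > 0 \<Longrightarrow> h (t *\<^sub>R x) = h x" "\<And>x. h x \<ge> 0"
    and u: "\<And>r. r \<ge> 0 \<Longrightarrow> u r \<ge> 0" and v: "\<And>r. r \<ge> 0 \<Longrightarrow> v r \<ge> 0"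
    and deriv: "\<And>r. r \<ge> 0 \<Longrightarrow> DERIV (\<lambda>r. u r * exp (- r\<^sup>2 / 2)) r :> - v r"
    and lim: "((\<lambda>r. u r * exp (- r\<^sup>2 / 2)) \<longlongrightarrow> 0) at_top"
  shows "(\<integral>\<^sup>+x. ennreal (h x * u (norm x)) \<partial>std_gaussian)
    = (\<integral>\<^sup>+x. ennreal (u (norm x)) \<partial>(std_gaussian :: 'a measure))
      * (\<integral>\<^sup>+x. ennreal (h x) \<partial>uniform_measure lborel (cball 0 1))"
proof -
  let ?V = "\<lambda>r. u r * exp (- r\<^sup>2 / 2)"
  let ?c = "(1 / sqrt (2 * pi)) ^ DIM('a)"
  define K where "K = (\<integral>\<^sup>+t. ennreal (v t) * ennreal (max 0 t ^ DIM('a)) \<partial>lborel)"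
  let ?A = "\<lambda>h :: 'a \<Rightarrow> ennreal. \<integral>\<^sup>+x. h x * indicator (cball 0 1) x \<partial>lborel"
  have W: "ennreal (?V r) = (\<integral>\<^sup>+t. ennreal (v t) * indicator {r..} t \<partial>lborel)" if r: "r \<ge> 0" for r
  proof -
    have "(\<integral>\<^sup>+t. ennreal (v t) * indicator {r..} t \<partial>lborel) = ennreal (- 0 - - ?V r)"
    proof (rule nn_integral_FTC_atLeast)
      show "DERIV (\<lambda>r. - ?V r) x :> v x" if "r \<le> x" for x
        using DERIV_minus[OF deriv[of x]] r that by simp
      show "((\<lambda>r. - ?V r) \<longlongrightarrow> - 0) at_top" by (rule tendsto_minus[OF lim])
    qed (use r v in auto)
    then show ?thesis by simp
  qed
  have rad: "(\<integral>\<^sup>+x. ennreal (f x * u (norm x)) \<partial>std_gaussian) = ennreal ?c * (K * ?A (\<lambda>x. ennreal (f x)))"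
    if [measurable]: "f \<in> borel_measurable borel"
      and f: "\<And>t x. t > 0 \<Longrightarrow> f (t *\<^sub>R x) = f x" "\<And>x. f x \<ge> 0" for f :: "'a \<Rightarrow> real"
  proof -
    have "(\<integral>\<^sup>+x. ennreal (f x * u (norm x)) \<partial>std_gaussian)
        = (\<integral>\<^sup>+x. ennreal ?c * (ennreal (f x) * ennreal (?V (norm x))) \<partial>lborel)"
    proof (subst nn_integral_std_gaussian, measurable, intro nn_integral_cong)
      fix x :: 'a
      have "std_gaussian_density x * (f x * u (norm x)) = ?c * (f x * ?V (norm x))"
        by (simp add: std_gaussian_density_eq)
      then show "ennreal (std_gaussian_density x) * ennreal (f x * u (norm x))
          = ennreal ?c * (ennreal (f x) * ennreal (?V (norm x)))"
        using f(2) u by (simp only: ennreal_mult'[symmetric] ennreal_mult''[symmetric]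
            std_gaussian_density_nonneg norm_ge_zero mult_nonneg_nonneg exp_ge_zero)
    qed
    also have "\<dots> = ennreal ?c * (\<integral>\<^sup>+x. ennreal (f x) * ennreal (?V (norm x)) \<partial>lborel)"
      by (rule nn_integral_cmult) measurable
    also have "(\<integral>\<^sup>+x. ennreal (f x) * ennreal (?V (norm x)) \<partial>lborel) = K * ?A (\<lambda>x. ennreal (f x))"
      unfolding K_def by (rule nn_integral_radial[where W = "\<lambda>r. ennreal (?V r)"]) (use f W in auto)
    finally show ?thesis .
  qed
  define vol where "vol = emeasure lborel (cball 0 1 :: 'a set)"
  have vol: "vol \<noteq> 0" "vol \<noteq> \<top>"
    using unit_ball_vol_pos[of "real DIM('a)"] by (auto simp: vol_def emeasure_cball simp del: unit_ball_vol_pos)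
  \<comment> \<open>The case f = 1 evaluates the common constant, so \<open>K\<close> never has to
    be computed.\<close>
  have "(\<integral>\<^sup>+x. ennreal (u (norm x)) \<partial>(std_gaussian :: 'a measure)) = ennreal ?c * (K * vol)"
    using rad[of "\<lambda>_. 1"] by (simp add: vol_def)
  moreover have "(\<integral>\<^sup>+x. ennreal (h x * u (norm x)) \<partial>std_gaussian) = ennreal ?c * (K * ?A (\<lambda>x. ennreal (h x)))"
    using h by (intro rad) auto
  moreover have "(\<integral>\<^sup>+x. ennreal (h x) \<partial>uniform_measure lborel (cball 0 1)) = ?A (\<lambda>x. ennreal (h x)) / vol"
    unfolding vol_def by (rule nn_integral_uniform_measure) auto
  moreover have "vol * (a / vol) = a" for a
    using vol by (simp add: ennreal_times_divide mult.commute[of vol] ennreal_mult_divide_eq)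
  ultimately show ?thesis by (simp add: mult.assoc)
qed

text \<open>
  The radial weights \<open>exp (- r\<^sup>2 / 2)\<close> and \<open>(r\<^sup>2 + 2) exp (- r\<^sup>2 / 2)\<close> are both decreasing, unlike
  \<open>r\<^sup>2 exp (- r\<^sup>2 / 2)\<close>, so the second moment is reached as a difference of two layer cake formulas.
\<close>

lemma statistical_dimension_uniform_sphere:
  fixes C :: "'a::euclidean_space set"
  assumes C: "closed_convex_cone C"
  shows "(\<integral>\<^sup>+x. ennreal ((norm (closest_point C x))\<^sup>2) \<partial>uniform_sphere)
    = ennreal (statistical_dimension C / real DIM('a))"
proof -
  interpret prob_space "std_gaussian :: 'a measure" by (rule prob_space_std_gaussian)
  note [measurable] = borel_measurable_closest_point[OF C]
  define h where "h x = (norm (closest_point C (x /\<^sub>R norm x)))\<^sup>2" for x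
  have [measurable]: "h \<in> borel_measurable borel" unfolding h_def by measurable
  have hx: "h x * (norm x)\<^sup>2 = (norm (closest_point C x))\<^sup>2" for x
  proof (cases "x = 0")
    case False
    then show ?thesis
      by (simp add: h_def closest_point_cone_scaleR[OF C] power_mult_distrib power_divide field_simps)
  qed (use norm_closest_point_cone_le[OF C, of 0] in auto)
  have h1: "h x \<le> 1" for x
  proof -
    have "norm (closest_point C (x /\<^sub>R norm x)) \<le> 1"
      using norm_closest_point_cone_le[OF C, of "x /\<^sub>R norm x"] by (cases "x = 0") auto
    then show ?thesis by (simp add: h_def power_le_one)
  qed
  have h0: "h x \<ge> 0" "t > 0 \<Longrightarrow> h (t *\<^sub>R x) = h x" for t x
    by (auto simp: h_def field_simps)
  define a where "a = (\<integral>\<^sup>+x. ennreal (h x) \<partial>uniform_measure lborel (cball 0 1 :: 'a set))"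
  have a: "(\<integral>\<^sup>+x. ennreal (h x) \<partial>std_gaussian) = a"
  proof -
    have "(\<integral>\<^sup>+x. ennreal (h x * 1) \<partial>std_gaussian) = (\<integral>\<^sup>+x. ennreal 1 \<partial>(std_gaussian :: 'a measure)) * a"
      unfolding a_def
    proof (rule std_gaussian_homogeneous[where u = "\<lambda>_. 1" and v = "\<lambda>t. t * exp (- t\<^sup>2 / 2)"])
      show "((\<lambda>r::real. 1 * exp (- r\<^sup>2 / 2)) \<longlongrightarrow> 0) at_top" by real_asymp
      show "DERIV (\<lambda>r. 1 * exp (- r\<^sup>2 / 2)) r :> - (r * exp (- r\<^sup>2 / 2))" for r :: real
        by (auto intro!: derivative_eq_intros)
    qed (use h0 in auto)
    then show ?thesis using emeasure_space_1 by simp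
  qed
  have a': "(\<integral>\<^sup>+x. ennreal (h x * ((norm x)\<^sup>2 + 2)) \<partial>std_gaussian)
      = (\<integral>\<^sup>+x. ennreal ((norm x)\<^sup>2 + 2) \<partial>(std_gaussian :: 'a measure)) * a"
    unfolding a_def
  \<comment> \<open>For r^2 + c the derivative is -r (r^2 + c - 2) exp (-r^2 / 2); c = 2 is the
    least constant for which it is nonpositive for all r >= 0.\<close>
  proof (rule std_gaussian_homogeneous[where u = "\<lambda>r. r\<^sup>2 + 2" and v = "\<lambda>t. t ^ 3 * exp (- t\<^sup>2 / 2)"])
    show "((\<lambda>r::real. (r\<^sup>2 + 2) * exp (- r\<^sup>2 / 2)) \<longlongrightarrow> 0) at_top" by real_asymp
    show "DERIV (\<lambda>r. (r\<^sup>2 + 2) * exp (- r\<^sup>2 / 2)) r :> - (r ^ 3 * exp (- r\<^sup>2 / 2))" for r :: real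
      by (auto intro!: derivative_eq_intros simp: algebra_simps power2_eq_square power3_eq_cube)
  qed (use h0 in auto)
  have "a \<le> (\<integral>\<^sup>+x. 1 \<partial>(std_gaussian :: 'a measure))"
    unfolding a[symmetric] using h1 by (intro nn_integral_mono) (simp add: ennreal_le_1)
  then have "a \<noteq> \<top>" using emeasure_space_1 by (auto simp: top_unique)
  then obtain \<alpha> where \<alpha>: "a = ennreal \<alpha>" "\<alpha> \<ge> 0" by (cases a) auto
  have "(\<integral>\<^sup>+x. ennreal ((norm x)\<^sup>2 + 2) \<partial>(std_gaussian :: 'a measure)) = ennreal (real DIM('a) + 2)"
    using std_gaussian_second_moment[where 'a = 'a] prob_space emeasure_space_1
    by (simp add: nn_integral_add nn_integral_eq_integral has_bochner_integral_iff ennreal_plus[symmetric] del: ennreal_plus)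
  moreover have "(\<integral>\<^sup>+x. ennreal (h x * ((norm x)\<^sup>2 + 2)) \<partial>std_gaussian) = ennreal (statistical_dimension C) + 2 * a"
  proof -
    have "(\<integral>\<^sup>+x. ennreal (h x * ((norm x)\<^sup>2 + 2)) \<partial>std_gaussian)
        = (\<integral>\<^sup>+x. ennreal ((norm (closest_point C x))\<^sup>2) + 2 * ennreal (h x) \<partial>std_gaussian)"
      by (intro nn_integral_cong) (simp add: distrib_left hx h0 ennreal_mult mult.commute)
    also have "\<dots> = ennreal (statistical_dimension C) + 2 * a"
      by (simp add: nn_integral_add nn_integral_cmult nn_integral_statistical_dimension[OF C] a)
    finally show ?thesis .
  qed
  \<comment> \<open>The extra 2 contributes 2 \<alpha> on both sides and cancels, leaving the
    statistical dimension equal to d \<alpha>.\<close>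
  ultimately have "ennreal (statistical_dimension C + 2 * \<alpha>) = ennreal ((real DIM('a) + 2) * \<alpha>)"
    using a' \<alpha> statistical_dimension_nonneg[OF C] by (simp add: ennreal_mult)
  then have "statistical_dimension C + 2 * \<alpha> = (real DIM('a) + 2) * \<alpha>"
    using \<alpha> statistical_dimension_nonneg[OF C] by (subst (asm) ennreal_inj) auto
  then have "\<alpha> = statistical_dimension C / real DIM('a)" by (simp add: field_simps)
  moreover have "(\<integral>\<^sup>+x. ennreal ((norm (closest_point C x))\<^sup>2) \<partial>uniform_sphere) = a"
    unfolding uniform_sphere_def a_def h_def by (subst nn_integral_distr) auto
  ultimately show ?thesis using \<alpha> by simp
qed

text \<open>Integrability is recorded along with the value because the Bochner integral of a
  nonintegrable function is 0 by convention.\<close>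

lemma expectation_std_normal_vector:
  fixes g :: "'w \<Rightarrow> 'a::euclidean_space" and f :: "'a \<Rightarrow> real"
  assumes g: "std_normal_vector M g" and f: "has_bochner_integral std_gaussian f c"
  shows "integrable M (\<lambda>\<omega>. f (g \<omega>)) \<and> c = prob_space.expectation M (\<lambda>\<omega>. f (g \<omega>))"
proof -
  have g': "distr M lborel g = std_gaussian" "g \<in> M \<rightarrow>\<^sub>M lborel"
    using g by (auto simp: std_normal_vector_def distributed_def std_gaussian_def)
  have "f \<in> borel_measurable lborel" using borel_measurable_has_bochner_integral[OF f] by simp
  then show ?thesis
    using f integrable_distr_eq[OF g'(2), of f] integral_distr[OF g'(2), of f]
    unfolding g'(1) has_bochner_integral_iff by simp
qed

theorem proposition3p1:
  fixes C :: "(real ^ 'n) set"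
    and M :: "'w measure" and g :: "'w \<Rightarrow> real ^ 'n"
    and N :: "'z measure" and \<theta> :: "'z \<Rightarrow> real ^ 'n"
  assumes C: "closed_convex_cone C"
    and g: "std_normal_vector M g"
    and \<theta>: "uniform_on_sphere N \<theta>"
  shows
    "statistical_dimension C = (\<Sum>k=0..CARD('n). real k * conic_intrinsic_volume k C)
   \<and> (integrable M (\<lambda>\<omega>. (norm (closest_point C (g \<omega>)))\<^sup>2) \<and>
      statistical_dimension C = prob_space.expectation M (\<lambda>\<omega>. (norm (closest_point C (g \<omega>)))\<^sup>2))
   \<and> (integrable N (\<lambda>\<omega>. (norm (closest_point C (\<theta> \<omega>)))\<^sup>2) \<and>
      statistical_dimension C =
        real CARD('n) * prob_space.expectation N (\<lambda>\<omega>. (norm (closest_point C (\<theta> \<omega>)))\<^sup>2))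
   \<and> (integrable M (\<lambda>\<omega>. (infdist (g \<omega>) (polar_cone C))\<^sup>2) \<and>
      statistical_dimension C =
        prob_space.expectation M (\<lambda>\<omega>. (infdist (g \<omega>) (polar_cone C))\<^sup>2))
   \<and> (integrable M (\<lambda>\<omega>. (SUP y\<in>C \<inter> cball 0 1. y \<bullet> g \<omega>)\<^sup>2) \<and>
      statistical_dimension C =
        prob_space.expectation M (\<lambda>\<omega>. (SUP y\<in>C \<inter> cball 0 1. y \<bullet> g \<omega>)\<^sup>2))
   \<and> (\<forall>U :: real ^ 'n ^ 'n. orthogonal_matrix U \<longrightarrow>
        statistical_dimension ((\<lambda>x. U *v x) ` C) = statistical_dimension C)
   \<and> (\<forall>L :: (real ^ 'n) set. subspace L \<longrightarrow> statistical_dimension L = real (dim L))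
   \<and> statistical_dimension C + statistical_dimension (polar_cone C) = real CARD('n)
   \<and> ((\<forall>K :: (real ^ 'n) set. closed_convex_cone K \<longrightarrow>
        statistical_dimension (C \<times> K) = statistical_dimension C + statistical_dimension K) \<and>
      statistical_dimension (C \<times> {0 :: real ^ 'm}) = statistical_dimension C)
   \<and> (\<forall>K :: (real ^ 'n) set. closed_convex_cone K \<longrightarrow> C \<subseteq> K \<longrightarrow>
        statistical_dimension C \<le> statistical_dimension K)"
proof -
  let ?q = "\<lambda>x. (norm (closest_point C x))\<^sup>2"
  note gauss = expectation_std_normal_vector[OF g statistical_dimension_std_gaussian[OF C]]
  have sphere: "has_bochner_integral N (\<lambda>\<omega>. ?q (\<theta> \<omega>)) (statistical_dimension C / real CARD('n))"
  proof (rule has_bochner_integral_nn_integral)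
    note [measurable] = borel_measurable_closest_point[OF C]
    have [measurable]: "\<theta> \<in> borel_measurable N" and d: "distr N borel \<theta> = uniform_sphere"
      using \<theta> by (auto simp: uniform_on_sphere_def)
    show "(\<lambda>\<omega>. ?q (\<theta> \<omega>)) \<in> borel_measurable N" by measurable
    have "(\<integral>\<^sup>+\<omega>. ennreal (?q (\<theta> \<omega>)) \<partial>N) = (\<integral>\<^sup>+x. ennreal (?q x) \<partial>distr N borel \<theta>)"
      by (subst nn_integral_distr) auto
    then show "(\<integral>\<^sup>+\<omega>. ennreal (?q (\<theta> \<omega>)) \<partial>N) = ennreal (statistical_dimension C / real CARD('n))"
      unfolding d by (simp add: statistical_dimension_uniform_sphere[OF C])
  qed (use statistical_dimension_nonneg[OF C] in auto)
  have orth: "orthogonal_transformation (\<lambda>x. U *v x)" if "orthogonal_matrix U" for U :: "real ^ 'n ^ 'n"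
    using that by (simp add: orthogonal_transformation_matrix)
  have zero: "subspace {0 :: real ^ 'm}" by (simp add: subspace_def)
  have "statistical_dimension C = (\<Sum>k=0..CARD('n). real k * conic_intrinsic_volume k C)"
    by (simp add: statistical_dimension_def)
  moreover have "integrable N (\<lambda>\<omega>. ?q (\<theta> \<omega>)) \<and>
      statistical_dimension C = real CARD('n) * prob_space.expectation N (\<lambda>\<omega>. ?q (\<theta> \<omega>))"
    using sphere by (simp add: has_bochner_integral_iff)
  moreover have "statistical_dimension ((\<lambda>x. U *v x) ` C) = statistical_dimension C"
    if "orthogonal_matrix U" for U :: "real ^ 'n ^ 'n"
    by (rule statistical_dimension_orthogonal_image[OF C orth[OF that]])
  moreover have "statistical_dimension C + statistical_dimension (polar_cone C) = real CARD('n)"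
    using statistical_dimension_polar[OF C] by simp
  moreover have "statistical_dimension (C \<times> {0 :: real ^ 'm}) = statistical_dimension C"
    using statistical_dimension_Times[OF C subspace_closed_convex_cone[OF zero]]
    by (simp add: statistical_dimension_subspace[OF zero])
  ultimately show ?thesis
    \<comment> \<open>Distance to the polar cone and width over the unit ball both equal the
      projection length pointwise, so these two items become the Gaussian one.\<close>
    unfolding infdist_polar_cone[OF C] SUP_inner_cone_cball[OF C]
    using gauss statistical_dimension_subspace statistical_dimension_Times[OF C] statistical_dimension_mono[OF C]
    by (intro conjI allI impI) auto
qed

end
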